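(* Let $\mathcal H$ be a Hilbert space of finite dimension $d$ and $\mathcal K$ a finite-dimensional Hilbert space. Let $\{|e_s\rangle\}_{s=0}^{d-1}$ be an orthonormal basis of $\mathcal H$, $\{\lambda_s\}_{s=0}^{d-1}$ a probability distribution, $V=\sum_{s=0}^{d-1}\exp\!\left(i\frac{2\pi s}{d}\right)|e_s\rangle\langle e_s|$, and $\Phi(\sigma)=\sum_{j=0}^{d-1}\lambda_jV^j\sigma V^{*j}$ the corresponding phase damping channel on $\mathfrak S(\mathcal H)$. Let $\mathcal A$ be the set of states on $\mathcal H$ that can be written as convex combinations of pure states $|f\rangle\langle f|$ with $|\langle f|e_s\rangle|=\frac1{\sqrt d}$ for all $s$. Suppose $\rho\in\mathfrak S(\mathcal H\otimes\mathcal K)$ satisfies $\mathrm{Tr}_{\mathcal K}(\rho)\in\mathcal A$. Then for every quantum channel $\Omega:\mathfrak S(\mathcal K)\to\mathfrak S(\mathcal K)$, $$S((\Phi\otimes\Omega)(\rho))\ge-\sum_{j=0}^{d-1}\lambda_j\log\lambda_j+H_\Omega(\mathrm{Tr}_{\mathcal H}(\rho))\ge H_\Phi(\mathrm{Tr}_{\mathcal K}(\rho))+H_\Omega(\mathrm{Tr}_{\mathcal H}(\rho)).$$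
   Context: $\mathfrak S(\cdot)$ denotes the set of density operators; a quantum channel is a completely positive trace-preserving linear map; $S(\sigma)=-\mathrm{Tr}(\sigma\log\sigma)$ is the von Neumann entropy. For a channel $\Psi$ with input space $\mathcal L$ and $\sigma\in\mathfrak S(\mathcal L)$, $H_\Psi(\sigma):=\min\sum_{j}\pi_jS(\Psi(\sigma_j))$, the minimum over all finite decompositions $\sigma=\sum_j\pi_j\sigma_j$ with $\{\pi_j\}$ a probability distribution and $\sigma_j\in\mathfrak S(\mathcal L)$. *)

theory Defs
  imports "Jordan_Normal_Form.Matrix" "Jordan_Normal_Form.Char_Poly"
    "HOL-Computational_Algebra.Polynomial"
begin

definition ctrace :: "complex mat \<Rightarrow> complex" where
  "ctrace A = (\<Sum>i<dim_row A. A $$ (i, i))"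

definition cadj :: "complex mat \<Rightarrow> complex mat" where
  "cadj A = mat (dim_col A) (dim_row A) (\<lambda>(i, j). cnj (A $$ (j, i)))"

definition cinner :: "complex vec \<Rightarrow> complex vec \<Rightarrow> complex" where
  "cinner v w = (\<Sum>i<dim_vec v. cnj (v $ i) * w $ i)"

definition outer :: "complex vec \<Rightarrow> complex vec \<Rightarrow> complex mat" where
  "outer v w = mat (dim_vec v) (dim_vec w) (\<lambda>(i, j). v $ i * cnj (w $ j))"

definition psd :: "nat \<Rightarrow> complex mat \<Rightarrow> bool" where
  "psd n A \<longleftrightarrow> A \<in> carrier_mat n n \<and> cadj A = A \<and>
     (\<forall>v \<in> carrier_vec n. cinner v (A *\<^sub>v v) \<in> \<real> \<and> Re (cinner v (A *\<^sub>v v)) \<ge> 0)"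

definition density :: "nat \<Rightarrow> complex mat set" where
  "density n = {A. psd n A \<and> ctrace A = 1}"

text \<open>Von Neumann entropy: S(A) = - Tr (A log A) = - sum over the eigenvalues (with
  multiplicity, i.e. roots of the characteristic polynomial) of mu log mu, with 0 log 0 = 0.\<close>
definition eta :: "real \<Rightarrow> real" where
  "eta x = (if x \<le> 0 then 0 else - x * ln x)"

definition vN_entropy :: "complex mat \<Rightarrow> real" where
  "vN_entropy A = (\<Sum>\<^sub># (image_mset (\<lambda>\<mu>. eta (Re \<mu>)) (proots (char_poly A))))"

text \<open>Entrywise finite sum of n x n matrices (matrices do not form a monoid in JNF).\<close>
definition msum :: "nat \<Rightarrow> nat \<Rightarrow> (nat \<Rightarrow> complex mat) \<Rightarrow> complex mat" where
  "msum n N f = mat n n (\<lambda>(i, j). \<Sum>k<N. f k $$ (i, j))"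

section \<open>Bipartite systems C^d (x) C^m, index (a, b) \<mapsto> a * m + b\<close>

definition tensor_mat :: "nat \<Rightarrow> nat \<Rightarrow> complex mat \<Rightarrow> complex mat \<Rightarrow> complex mat" where
  "tensor_mat d m A B = mat (d * m) (d * m)
     (\<lambda>(i, j). A $$ (i div m, j div m) * B $$ (i mod m, j mod m))"

definition ptrace2 :: "nat \<Rightarrow> nat \<Rightarrow> complex mat \<Rightarrow> complex mat" where
  "ptrace2 d m X = mat d d (\<lambda>(a, a'). \<Sum>b<m. X $$ (a * m + b, a' * m + b))"

definition ptrace1 :: "nat \<Rightarrow> nat \<Rightarrow> complex mat \<Rightarrow> complex mat" where
  "ptrace1 d m X = mat m m (\<lambda>(b, b'). \<Sum>a<d. X $$ (a * m + b, a * m + b'))"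

text \<open>(Psi (x) id)(X) for a linear map Psi on d x d matrices.\<close>
definition left_apply :: "nat \<Rightarrow> nat \<Rightarrow> (complex mat \<Rightarrow> complex mat) \<Rightarrow> complex mat \<Rightarrow> complex mat" where
  "left_apply d m \<Psi> X = mat (d * m) (d * m) (\<lambda>(i, j).
     \<Psi> (mat d d (\<lambda>(x, y). X $$ (x * m + i mod m, y * m + j mod m))) $$ (i div m, j div m))"

text \<open>(id (x) Omega)(X) for a linear map Omega on m x m matrices.\<close>
definition right_apply :: "nat \<Rightarrow> nat \<Rightarrow> (complex mat \<Rightarrow> complex mat) \<Rightarrow> complex mat \<Rightarrow> complex mat" where
  "right_apply d m \<Omega> X = mat (d * m) (d * m) (\<lambda>(i, j).
     \<Omega> (mat m m (\<lambda>(x, y). X $$ ((i div m) * m + x, (j div m) * m + y))) $$ (i mod m, j mod m))"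

definition tensor_map :: "nat \<Rightarrow> nat \<Rightarrow> (complex mat \<Rightarrow> complex mat) \<Rightarrow> (complex mat \<Rightarrow> complex mat)
     \<Rightarrow> complex mat \<Rightarrow> complex mat" where
  "tensor_map d m \<Psi> \<Omega> X = left_apply d m \<Psi> (right_apply d m \<Omega> X)"

definition linear_map_on :: "nat \<Rightarrow> (complex mat \<Rightarrow> complex mat) \<Rightarrow> bool" where
  "linear_map_on n \<Omega> \<longleftrightarrow>
     (\<forall>A \<in> carrier_mat n n. \<Omega> A \<in> carrier_mat n n) \<and>
     (\<forall>A \<in> carrier_mat n n. \<forall>B \<in> carrier_mat n n. \<Omega> (A + B) = \<Omega> A + \<Omega> B) \<and>
     (\<forall>A \<in> carrier_mat n n. \<forall>c. \<Omega> (c \<cdot>\<^sub>m A) = c \<cdot>\<^sub>m \<Omega> A)"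

definition completely_positive :: "nat \<Rightarrow> (complex mat \<Rightarrow> complex mat) \<Rightarrow> bool" where
  "completely_positive n \<Omega> \<longleftrightarrow>
     (\<forall>k X. psd (k * n) X \<longrightarrow> psd (k * n) (right_apply k n \<Omega> X))"

definition trace_preserving :: "nat \<Rightarrow> (complex mat \<Rightarrow> complex mat) \<Rightarrow> bool" where
  "trace_preserving n \<Omega> \<longleftrightarrow> (\<forall>A \<in> carrier_mat n n. ctrace (\<Omega> A) = ctrace A)"

definition quantum_channel :: "nat \<Rightarrow> (complex mat \<Rightarrow> complex mat) \<Rightarrow> bool" where
  "quantum_channel n \<Omega> \<longleftrightarrow> linear_map_on n \<Omega> \<and> completely_positive n \<Omega> \<and> trace_preserving n \<Omega>"

text \<open>H_Psi(sigma): infimum (the paper: minimum) over finite decompositions of sigma into states.\<close>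
definition H_chan :: "nat \<Rightarrow> (complex mat \<Rightarrow> complex mat) \<Rightarrow> complex mat \<Rightarrow> real" where
  "H_chan n \<Psi> \<sigma> = Inf {(\<Sum>j<N. \<pi> j * vN_entropy (\<Psi> (\<sigma>s j))) | N \<pi> \<sigma>s.
      (\<forall>j<N. \<pi> j \<ge> 0 \<and> \<sigma>s j \<in> density n) \<and> (\<Sum>j<N. \<pi> j) = 1 \<and>
      \<sigma> = msum n N (\<lambda>j. complex_of_real (\<pi> j) \<cdot>\<^sub>m \<sigma>s j)}"

definition orthonormal_basis :: "nat \<Rightarrow> (nat \<Rightarrow> complex vec) \<Rightarrow> bool" where
  "orthonormal_basis d e \<longleftrightarrow> (\<forall>s<d. e s \<in> carrier_vec d) \<and>
     (\<forall>s<d. \<forall>t<d. cinner (e s) (e t) = (if s = t then 1 else 0))"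

definition prob_dist :: "nat \<Rightarrow> (nat \<Rightarrow> real) \<Rightarrow> bool" where
  "prob_dist d lam \<longleftrightarrow> (\<forall>j<d. lam j \<ge> 0) \<and> (\<Sum>j<d. lam j) = 1"

definition phase_unitary :: "nat \<Rightarrow> (nat \<Rightarrow> complex vec) \<Rightarrow> complex mat" where
  "phase_unitary d e = msum d d (\<lambda>s. exp (\<i> * complex_of_real (2 * pi * real s / real d)) \<cdot>\<^sub>m outer (e s) (e s))"

definition phase_damping :: "nat \<Rightarrow> (nat \<Rightarrow> complex vec) \<Rightarrow> (nat \<Rightarrow> real) \<Rightarrow> complex mat \<Rightarrow> complex mat" where
  "phase_damping d e lam \<sigma> = msum d d (\<lambda>j. complex_of_real (lam j) \<cdot>\<^sub>m
       (phase_unitary d e ^\<^sub>m j * \<sigma> * cadj (phase_unitary d e ^\<^sub>m j)))"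

definition unbiased_states :: "nat \<Rightarrow> (nat \<Rightarrow> complex vec) \<Rightarrow> complex mat set" where
  "unbiased_states d e = {\<sigma>. \<exists>N p f.
      (\<forall>j<N. p j \<ge> 0 \<and> f j \<in> carrier_vec d \<and> (\<forall>s<d. cmod (cinner (f j) (e s)) = 1 / sqrt (real d))) \<and>
      (\<Sum>j<N. p j) = 1 \<and>
      \<sigma> = msum d N (\<lambda>j. complex_of_real (p j) \<cdot>\<^sub>m outer (f j) (f j))}"

end

theory Submission
  imports Defs "Jordan_Normal_Form.Determinant" "HOL-Computational_Algebra.Fundamental_Theorem_Algebra"
begin

text \<open>
  Write \<open>X\<close> for the state obtained from \<open>\<rho>\<close> by applying \<open>\<Omega>\<close> to the second factor, and \<open>X\<^sub>j\<close> for its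
  conjugate by \<open>V\<^sup>j \<otimes> 1\<close>. The output of the channel is \<open>A = \<Sum>\<^sub>j \<lambda>\<^sub>j X\<^sub>j\<close>, and the uniform mixture
  \<open>B = \<Sum>\<^sub>j X\<^sub>j / d\<close> is the part of \<open>X\<close> that is block diagonal in the basis \<open>e\<close>. Preparing \<open>X\<^sub>j\<close> with
  probability \<open>\<lambda>\<^sub>j\<close> does not increase relative entropy, so \<open>S(A || B) \<le> D(\<lambda> || uniform) = log d - H(\<lambda>)\<close>,
  while \<open>S(A || B) = S(B) - S(A)\<close> because \<open>A\<close> and \<open>B\<close> have the same diagonal blocks. The unbiasedness of the
  first marginal says that every diagonal block of \<open>\<rho>\<close> has trace \<open>1/d\<close>; hence the normalized
  blocks \<open>\<rho>\<^sub>s\<close> form a decomposition of the second marginal and \<open>S(B) = log d + (1/d) \<Sum>\<^sub>s S(\<Omega>(\<rho>\<^sub>s)) \<ge> log d + H\<^sub>\<Omega>\<close>. For the second inequality,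
  the vectors \<open>V\<^sup>j f\<close> are orthonormal when \<open>f\<close> is unbiased, so the phase damping channel maps \<open>|f><f|\<close> to a
  state with spectrum \<open>\<lambda>\<close>.
\<close>

section \<open>Sesquilinear forms and the spectral theorem\<close>

text \<open>Vectors and matrices are functions on all of \<open>nat\<close> of which only the values
  at indices below \<open>n\<close> matter; product vectors can then be written as plain functions
  of \<open>i div m\<close> and \<open>i mod m\<close>.\<close>

definition ip :: "nat \<Rightarrow> (nat \<Rightarrow> complex) \<Rightarrow> (nat \<Rightarrow> complex) \<Rightarrow> complex" where
  "ip n v w = (\<Sum>i<n. cnj (v i) * w i)"

definition sesq :: "nat \<Rightarrow> (nat \<Rightarrow> nat \<Rightarrow> complex) \<Rightarrow> (nat \<Rightarrow> complex) \<Rightarrow> (nat \<Rightarrow> complex) \<Rightarrow> complex" where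
  "sesq n M v w = (\<Sum>i<n. \<Sum>j<n. cnj (v i) * M i j * w j)"

definition onb :: "nat \<Rightarrow> (nat \<Rightarrow> nat \<Rightarrow> complex) \<Rightarrow> bool" where
  "onb n u \<longleftrightarrow> (\<forall>i<n. \<forall>j<n. ip n (u i) (u j) = (if i = j then 1 else 0))"

definition hermitian :: "nat \<Rightarrow> (nat \<Rightarrow> nat \<Rightarrow> complex) \<Rightarrow> bool" where
  "hermitian n M \<longleftrightarrow> (\<forall>i<n. \<forall>j<n. M i j = cnj (M j i))"

definition positive :: "nat \<Rightarrow> (nat \<Rightarrow> nat \<Rightarrow> complex) \<Rightarrow> bool" where
  "positive n M \<longleftrightarrow> hermitian n M \<and> (\<forall>v. 0 \<le> Re (sesq n M v v))"

text \<open>By completeness of \<open>u\<close> this says M u_i = a_i u_i; in terms of matrix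
  elements, an eigenbasis can be verified from values of the form alone.\<close>

definition diagonalizes :: "nat \<Rightarrow> (nat \<Rightarrow> nat \<Rightarrow> complex) \<Rightarrow> (nat \<Rightarrow> nat \<Rightarrow> complex) \<Rightarrow> (nat \<Rightarrow> real) \<Rightarrow> bool" where
  "diagonalizes n M u a \<longleftrightarrow> onb n u \<and>
     (\<forall>i<n. \<forall>j<n. sesq n M (u i) (u j) = (if i = j then complex_of_real (a i) else 0))"

section \<open>Sesquilinearity and hermitian forms\<close>

lemma ip_cong: "(\<And>i. i < n \<Longrightarrow> v i = v' i) \<Longrightarrow> (\<And>i. i < n \<Longrightarrow> w i = w' i) \<Longrightarrow> ip n v w = ip n v' w'"
  by (simp add: ip_def)

lemma sesq_cong:
  "(\<And>i j. i < n \<Longrightarrow> j < n \<Longrightarrow> M i j = M' i j) \<Longrightarrow> (\<And>i. i < n \<Longrightarrow> v i = v' i) \<Longrightarrow>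
   (\<And>i. i < n \<Longrightarrow> w i = w' i) \<Longrightarrow> sesq n M v w = sesq n M' v' w'"
  by (simp add: sesq_def)

lemma cnj_ip: "cnj (ip n v w) = ip n w v"
  by (simp add: ip_def mult.commute)

lemma ip_sum_left: "ip n (\<lambda>x. \<Sum>k\<in>K. c k * v k x) w = (\<Sum>k\<in>K. cnj (c k) * ip n (v k) w)"
proof -
  have "ip n (\<lambda>x. \<Sum>k\<in>K. c k * v k x) w = (\<Sum>i<n. \<Sum>k\<in>K. cnj (c k) * (cnj (v k i) * w i))"
    by (simp add: ip_def sum_distrib_right mult.assoc)
  also have "\<dots> = (\<Sum>k\<in>K. cnj (c k) * ip n (v k) w)"
    unfolding ip_def sum_distrib_left by (rule sum.swap)
  finally show ?thesis .
qed

lemma ip_sum_right: "ip n v (\<lambda>x. \<Sum>k\<in>K. c k * w k x) = (\<Sum>k\<in>K. c k * ip n v (w k))"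
proof -
  have "ip n v (\<lambda>x. \<Sum>k\<in>K. c k * w k x) = (\<Sum>i<n. \<Sum>k\<in>K. c k * (cnj (v i) * w k i))"
    by (simp add: ip_def sum_distrib_left mult.left_commute)
  also have "\<dots> = (\<Sum>k\<in>K. c k * ip n v (w k))"
    unfolding ip_def sum_distrib_left by (rule sum.swap)
  finally show ?thesis .
qed

lemma sesq_as_ip: "sesq n M v w = ip n v (\<lambda>i. \<Sum>j<n. M i j * w j)"
  by (simp add: sesq_def ip_def sum_distrib_left mult.assoc)

lemma sesq_sum_left: "sesq n M (\<lambda>x. \<Sum>k\<in>K. c k * v k x) w = (\<Sum>k\<in>K. cnj (c k) * sesq n M (v k) w)"
  unfolding sesq_as_ip by (rule ip_sum_left)

lemma sesq_sum_right: "sesq n M v (\<lambda>x. \<Sum>k\<in>K. c k * w k x) = (\<Sum>k\<in>K. c k * sesq n M v (w k))"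
proof -
  have "(\<Sum>j<n. M i j * (\<Sum>k\<in>K. c k * w k j)) = (\<Sum>k\<in>K. c k * (\<Sum>j<n. M i j * w k j))" for i
    unfolding sum_distrib_left by (subst sum.swap) (simp only: mult.left_commute)
  then show ?thesis by (simp add: sesq_as_ip ip_sum_right)
qed

lemma sesq_scale_left: "sesq n M (\<lambda>x. c * v x) w = cnj c * sesq n M v w"
  using sesq_sum_left[of n M "\<lambda>_::unit. c" "\<lambda>_. v" UNIV w] by simp

lemma sesq_scale_right: "sesq n M v (\<lambda>x. c * w x) = c * sesq n M v w"
  using sesq_sum_right[of n M v "\<lambda>_::unit. c" "\<lambda>_. w" UNIV] by simp

lemma ip_scale_left: "ip n (\<lambda>x. c * v x) w = cnj c * ip n v w"
  using ip_sum_left[of n "\<lambda>_::unit. c" "\<lambda>_. v" UNIV w] by simp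

lemma ip_scale_right: "ip n v (\<lambda>x. c * w x) = c * ip n v w"
  using ip_sum_right[of n v "\<lambda>_::unit. c" "\<lambda>_. w" UNIV] by simp

lemma sesq_sum_matrix:
  "sesq n (\<lambda>x y. \<Sum>k\<in>K. c k * M k x y) v w = (\<Sum>k\<in>K. c k * sesq n (M k) v w)"
proof -
  have "(\<Sum>k\<in>K. c k * sesq n (M k) v w) = (\<Sum>k\<in>K. \<Sum>i<n. \<Sum>j<n. c k * (cnj (v i) * M k i j * w j))"
    by (simp add: sesq_def sum_distrib_left)
  also have "\<dots> = (\<Sum>i<n. \<Sum>k\<in>K. \<Sum>j<n. c k * (cnj (v i) * M k i j * w j))"
    by (rule sum.swap)
  also have "\<dots> = (\<Sum>i<n. \<Sum>j<n. \<Sum>k\<in>K. c k * (cnj (v i) * M k i j * w j))"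
    by (intro sum.cong refl sum.swap)
  also have "\<dots> = sesq n (\<lambda>x y. \<Sum>k\<in>K. c k * M k x y) v w"
    by (simp add: sesq_def sum_distrib_left sum_distrib_right mult.assoc mult.left_commute)
  finally show ?thesis by simp
qed

lemma cnj_sesq:
  assumes "hermitian n M" shows "cnj (sesq n M v w) = sesq n M w v"
proof -
  have "cnj (sesq n M v w) = (\<Sum>i<n. \<Sum>j<n. v i * M j i * cnj (w j))"
    unfolding sesq_def cnj_sum
  proof (intro sum.cong refl)
    fix i j assume "i \<in> {..<n}" "j \<in> {..<n}"
    then have "M j i = cnj (M i j)" using assms unfolding hermitian_def by blast
    then show "cnj (cnj (v i) * M i j * w j) = v i * M j i * cnj (w j)" by simp
  qed
  also have "\<dots> = sesq n M w v"
    unfolding sesq_def by (subst sum.swap) (simp add: mult_ac)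
  finally show ?thesis .
qed

text \<open>Coordinate vectors recover the entries from the form. The criterion survives any
  substitution of arguments, which is how hermiticity of \<open>rotated\<close> and
  \<open>block\<close> is obtained.\<close>

lemma hermitian_iff_sesq:
  "hermitian n M \<longleftrightarrow> (\<forall>v w. cnj (sesq n M v w) = sesq n M w v)"
proof
  assume h: "\<forall>v w. cnj (sesq n M v w) = sesq n M w v"
  define \<delta> :: "nat \<Rightarrow> nat \<Rightarrow> complex" where "\<delta> i x = (if x = i then 1 else 0)" for i x
  have "sesq n M (\<delta> i) (\<delta> j) = M i j" if "i < n" "j < n" for i j
    using that by (simp add: sesq_def \<delta>_def if_distrib[of cnj] if_distrib[of "\<lambda>x. x * _"]
        if_distrib[of "\<lambda>x. _ * x"] cong: if_cong)
  then show "hermitian n M" unfolding hermitian_def using h by metis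
qed (use cnj_sesq in blast)

section \<open>Expansions and traces in an orthonormal basis\<close>

lemma onb_complete:
  assumes "onb n u" "i < n" "j < n"
  shows "(\<Sum>k<n. u k i * cnj (u k j)) = (if i = j then 1 else 0)"
proof -
  let ?U = "mat n n (\<lambda>(i, j). u j i)" and ?V = "mat n n (\<lambda>(i, j). cnj (u i j))"
  have "?V * ?U = 1\<^sub>m n"
    by (rule eq_matI)
       (use assms(1) in \<open>auto simp: onb_def ip_def scalar_prod_def lessThan_atLeast0\<close>)
  \<comment> \<open>Orthonormality is a one-sided inverse identity; for square matrices the other
    side follows, and that is completeness.\<close>
  then have "?U * ?V = 1\<^sub>m n"
    using mat_mult_left_right_inverse[of ?V n ?U] by simp
  then have "(?U * ?V) $$ (i, j) = 1\<^sub>m n $$ (i, j)" by simp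
  then show ?thesis
    using assms(2,3) by (simp add: scalar_prod_def lessThan_atLeast0)
qed

lemma onb_expand:
  assumes "onb n u" "x < n"
  shows "v x = (\<Sum>k<n. ip n (u k) v * u k x)"
proof -
  have "(\<Sum>k<n. ip n (u k) v * u k x) = (\<Sum>k<n. \<Sum>i<n. (u k x * cnj (u k i)) * v i)"
    unfolding ip_def sum_distrib_right by (intro sum.cong refl) simp
  also have "\<dots> = (\<Sum>i<n. (\<Sum>k<n. u k x * cnj (u k i)) * v i)"
    by (subst sum.swap) (simp add: sum_distrib_right)
  also have "\<dots> = (\<Sum>i<n. if x = i then v i else 0)"
    by (intro sum.cong refl) (simp add: onb_complete[OF assms])
  also have "\<dots> = v x" using assms(2) by simp
  finally show ?thesis by simp
qed

lemma parseval:
  assumes "onb n u"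
  shows "(\<Sum>k<n. ip n v (u k) * ip n (u k) w) = ip n v w"
proof -
  have "ip n v w = ip n v (\<lambda>x. \<Sum>k<n. ip n (u k) w * u k x)"
    by (rule ip_cong) (use onb_expand[OF assms] in auto)
  then show ?thesis unfolding ip_sum_right by (simp add: mult.commute)
qed

lemma trace_sesq:
  assumes "onb n u"
  shows "(\<Sum>k<n. sesq n M (u k) (u k)) = (\<Sum>i<n. M i i)"
proof -
  have "(\<Sum>k<n. sesq n M (u k) (u k)) = (\<Sum>k<n. \<Sum>i<n. \<Sum>j<n. M i j * (u k j * cnj (u k i)))"
    by (simp add: sesq_def mult_ac)
  also have "\<dots> = (\<Sum>i<n. \<Sum>k<n. \<Sum>j<n. M i j * (u k j * cnj (u k i)))"
    by (rule sum.swap)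
  also have "\<dots> = (\<Sum>i<n. \<Sum>j<n. \<Sum>k<n. M i j * (u k j * cnj (u k i)))"
    by (intro sum.cong refl sum.swap)
  also have "\<dots> = (\<Sum>i<n. \<Sum>j<n. if i = j then M i j else 0)"
    unfolding sum_distrib_left[symmetric]
    by (intro sum.cong refl) (simp add: onb_complete[OF assms])
  also have "\<dots> = (\<Sum>i<n. M i i)" by simp
  finally show ?thesis .
qed

lemma sesq_eigen_left:
  assumes "diagonalizes n M u a" "i < n"
  shows "sesq n M (u i) w = a i * ip n (u i) w"
proof -
  have o: "onb n u" using assms by (simp add: diagonalizes_def)
  have "sesq n M (u i) w = sesq n M (u i) (\<lambda>x. \<Sum>k<n. ip n (u k) w * u k x)"
    by (rule sesq_cong) (use onb_expand[OF o] in auto)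
  also have "\<dots> = (\<Sum>k<n. if i = k then ip n (u k) w * a i else 0)"
    unfolding sesq_sum_right
    by (intro sum.cong refl) (use assms in \<open>auto simp: diagonalizes_def\<close>)
  finally show ?thesis using assms(2) by simp
qed

lemma sesq_diagonal_expansion:
  assumes "diagonalizes n M u a"
  shows "sesq n M v v = (\<Sum>i<n. a i * (cmod (ip n (u i) v))\<^sup>2)"
proof -
  have o: "onb n u" using assms by (simp add: diagonalizes_def)
  have "sesq n M v v = sesq n M (\<lambda>x. \<Sum>k<n. ip n (u k) v * u k x) v"
    by (rule sesq_cong) (use onb_expand[OF o] in auto)
  also have "\<dots> = (\<Sum>i<n. a i * (cmod (ip n (u i) v))\<^sup>2)"
    unfolding sesq_sum_left
    by (auto simp: sesq_eigen_left[OF assms] complex_norm_square mult_ac simp del: of_real_power intro!: sum.cong)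
  finally show ?thesis .
qed

section \<open>Existence of eigenbases for hermitian matrices\<close>

lemma ip_self: "ip n v v = complex_of_real (\<Sum>i<n. (cmod (v i))\<^sup>2)"
  by (simp add: ip_def complex_norm_square mult.commute del: of_real_power)

lemma exists_normalized:
  assumes "\<exists>i<n. v i \<noteq> 0"
  shows "\<exists>c. c \<noteq> 0 \<and> ip n (\<lambda>x. c * v x) (\<lambda>x. c * v x) = 1"
proof -
  let ?r = "\<Sum>i<n. (cmod (v i))\<^sup>2"
  obtain i where "i < n" "v i \<noteq> 0" using assms by auto
  then have r: "?r > 0" by (intro sum_pos2[of _ i]) auto
  let ?c = "complex_of_real (1 / sqrt ?r)"
  have "ip n (\<lambda>x. ?c * v x) (\<lambda>x. ?c * v x) = ?c * ?c * complex_of_real ?r"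
    by (simp only: ip_scale_left ip_scale_right ip_self complex_cnj_complex_of_real mult.assoc)
  also have "\<dots> = complex_of_real (1 / sqrt ?r * (1 / sqrt ?r) * ?r)"
    by (simp only: of_real_mult)
  also have "1 / sqrt ?r * (1 / sqrt ?r) * ?r = 1"
    using r by (simp add: field_simps)
  finally have "ip n (\<lambda>x. ?c * v x) (\<lambda>x. ?c * v x) = 1" by simp
  moreover have "?c \<noteq> 0" using r by simp
  ultimately show ?thesis by blast
qed

text \<open>Take the matrix with rows <u_i, .> for \<open>i < k\<close> and zero rows below. Row
  \<open>k\<close> exists since \<open>k < n\<close>, so the matrix is singular and a normalized
  kernel vector serves.\<close>

lemma exists_orthogonal_unit:
  assumes "k < n"
  shows "\<exists>w. ip n w w = 1 \<and> (\<forall>i<k. ip n (u i) w = 0)"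
proof -
  let ?A = "mat n n (\<lambda>(i, j). if i < k then cnj (u i j) else 0)"
  have "?A = mat\<^sub>r n n (\<lambda>i. if i = k then 0\<^sub>v n else row ?A i)"
    by (rule eq_matI) auto
  then have "det ?A = 0" using det_row_0[of k n "row ?A"] assms by fastforce
  then obtain v where v: "v \<in> carrier_vec n" "v \<noteq> 0\<^sub>v n" "?A *\<^sub>v v = 0\<^sub>v n"
    using det_0_iff_vec_prod_zero[of ?A n] by auto
  have "\<exists>i<n. v $ i \<noteq> 0"
  proof (rule ccontr)
    assume "\<not> (\<exists>i<n. v $ i \<noteq> 0)"
    then have "v = 0\<^sub>v n" using v(1) by (intro eq_vecI) auto
    then show False using v(2) by simp
  qed
  then obtain c where c: "ip n (\<lambda>x. c * v $ x) (\<lambda>x. c * v $ x) = 1"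
    using exists_normalized[of n "\<lambda>i. v $ i"] by auto
  have "ip n (u i) (\<lambda>x. v $ x) = 0" if "i < k" for i
  proof -
    have "(?A *\<^sub>v v) $ i = 0" using v(3) that assms by simp
    then show ?thesis using that assms v(1)
      by (simp add: ip_def scalar_prod_def lessThan_atLeast0)
  qed
  then show ?thesis using c by (intro exI[of _ "\<lambda>x. c * v $ x"]) (auto simp: ip_scale_right)
qed

lemma exists_onb_extending:
  assumes "0 < n" "ip n v v = 1"
  shows "\<exists>u. onb n u \<and> u 0 = v"
proof -
  have "\<exists>u. u 0 = v \<and> (\<forall>i<k. \<forall>j<k. ip n (u i) (u j) = (if i = j then 1 else 0))"
    if "1 \<le> k" "k \<le> n" for k
    using that
  proof (induction k rule: dec_induct)
    case base
    show ?case using assms by (intro exI[of _ "\<lambda>_. v"]) auto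
  next
    case (step k)
    then obtain u where u: "u 0 = v" "\<forall>i<k. \<forall>j<k. ip n (u i) (u j) = (if i = j then 1 else 0)"
      by auto
    obtain w where w: "ip n w w = 1" "\<forall>i<k. ip n (u i) w = 0"
      using exists_orthogonal_unit[of k n u] step by auto
    have w': "\<forall>i<k. ip n w (u i) = 0"
      using w(2) by (metis cnj_ip complex_cnj_zero)
    show ?case using step(1) u w w'
      by (intro exI[of _ "u(k := w)"]) (auto simp: less_Suc_eq)
  qed
  from this[of n] show ?thesis using assms(1) unfolding onb_def by (metis Suc_leI One_nat_def order_refl)
qed

lemma exists_unit_eigenvector:
  assumes "0 < n"
  shows "\<exists>v z. ip n v v = 1 \<and> (\<forall>i<n. (\<Sum>j<n. M i j * v j) = z * v i)"
proof -
  let ?A = "mat n n (\<lambda>(i, j). M i j)"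
  have A: "?A \<in> carrier_mat n n" by simp
  have "degree (char_poly ?A) = n" using degree_monic_char_poly[OF A] by simp
  then have "\<not> constant (poly (char_poly ?A))" using assms by (simp add: constant_degree)
  then obtain z where "poly (char_poly ?A) z = 0"
    using fundamental_theorem_of_algebra by blast
  then have "eigenvalue ?A z" using eigenvalue_root_char_poly[OF A] by simp
  then obtain v where v: "v \<in> carrier_vec n" "v \<noteq> 0\<^sub>v n" "?A *\<^sub>v v = z \<cdot>\<^sub>v v"
    by (auto simp: eigenvalue_def eigenvector_def)
  have "\<exists>i<n. v $ i \<noteq> 0"
  proof (rule ccontr)
    assume "\<not> (\<exists>i<n. v $ i \<noteq> 0)"
    then have "v = 0\<^sub>v n" using v(1) by (intro eq_vecI) auto
    then show False using v(2) by simp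
  qed
  then obtain c where c: "ip n (\<lambda>x. c * v $ x) (\<lambda>x. c * v $ x) = 1"
    using exists_normalized[of n "\<lambda>i. v $ i"] by auto
  have "(\<Sum>j<n. M i j * (c * v $ j)) = z * (c * v $ i)" if "i < n" for i
  proof -
    have "(?A *\<^sub>v v) $ i = z * v $ i" using v that by simp
    then have "(\<Sum>j<n. M i j * v $ j) = z * v $ i" using that v(1)
      by (simp add: scalar_prod_def lessThan_atLeast0)
    then have "c * (\<Sum>j<n. M i j * v $ j) = c * (z * v $ i)" by simp
    then show ?thesis by (simp add: sum_distrib_left mult_ac)
  qed
  then show ?thesis using c by (intro exI[of _ "\<lambda>x. c * v $ x"] exI[of _ z]) auto
qed

text \<open>Splits off a unit eigenvector: hermiticity makes its eigenvalue real and its orthogonal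
  complement invariant, and the induction hypothesis diagonalizes the compression to that
  complement.\<close>

theorem spectral_theorem:
  assumes "hermitian n M"
  shows "\<exists>u a. diagonalizes n M u a"
  using assms
proof (induction n arbitrary: M)
  case 0
  then show ?case by (auto simp: diagonalizes_def onb_def)
next
  case (Suc n)
  obtain v z where v: "ip (Suc n) v v = 1" "\<forall>i<Suc n. (\<Sum>j<Suc n. M i j * v j) = z * v i"
    using exists_unit_eigenvector[of "Suc n" M] by auto
  obtain w where w: "onb (Suc n) w" "w 0 = v"
    using exists_onb_extending[OF _ v(1)] by auto
  have Mv: "sesq (Suc n) M y v = z * ip (Suc n) y v" for y
  proof -
    have "sesq (Suc n) M y v = ip (Suc n) y (\<lambda>x. z * v x)"
      unfolding sesq_as_ip by (rule ip_cong) (use v(2) in auto)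
    then show ?thesis by (simp add: ip_scale_right)
  qed
  have z: "z = complex_of_real (Re z)"
    using Mv[of v] v(1) cnj_sesq[OF Suc.prems, of v v] by (simp add: complex_eq_iff)
  \<comment> \<open>\<open>C\<close> is the matrix of \<open>M\<close> compressed to the span of
    w_1, ..., w_n; its eigenvectors are coordinate vectors, lifted back in \<open>u\<close>.\<close>
  define C where "C i j = sesq (Suc n) M (w (Suc i)) (w (Suc j))" for i j
  have "hermitian n C"
    by (auto simp: hermitian_def C_def cnj_sesq[OF Suc.prems])
  then obtain c b where c: "diagonalizes n C c b" using Suc.IH by blast
  define u where "u i = (case i of 0 \<Rightarrow> v | Suc i \<Rightarrow> (\<lambda>x. \<Sum>k<n. c i k * w (Suc k) x))" for i
  have ip_w: "ip (Suc n) (w i) (w j) = (if i = j then 1 else 0)" if "i < Suc n" "j < Suc n" for i j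
    using w(1) that by (auto simp: onb_def)
  have ip_ww: "ip (Suc n) (w (Suc i)) (w (Suc j)) = (if i = j then 1 else 0)" if "i < n" "j < n" for i j
    using ip_w that by auto
  have uu: "ip (Suc n) (u (Suc i)) (u (Suc j)) = ip n (c i) (c j)" for i j
    by (simp add: u_def ip_sum_left ip_sum_right ip_ww ip_def[of n] mult_ac if_distrib cong: if_cong)
  have u0: "ip (Suc n) v (u (Suc j)) = 0" for j
    using ip_w[of 0] by (auto simp: u_def ip_sum_right w(2) intro!: sum.neutral)
  have u0': "ip (Suc n) (u (Suc j)) v = 0" for j
    using u0[of j] by (metis cnj_ip complex_cnj_zero)
  have Mu: "sesq (Suc n) M (u (Suc i)) (u (Suc j)) = sesq n C (c i) (c j)" for i j
    by (simp add: u_def sesq_sum_left sesq_sum_right sesq_def[of n] C_def sum_distrib_left mult_ac)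
  have Mu0: "sesq (Suc n) M (u (Suc j)) v = 0" for j using Mv u0' by simp
  have Mu0': "sesq (Suc n) M v (u (Suc j)) = 0" for j
    using Mu0[of j] by (metis cnj_sesq[OF Suc.prems] complex_cnj_zero)
  have un: "u 0 = v" by (simp add: u_def)
  have "diagonalizes (Suc n) M u (\<lambda>i. case i of 0 \<Rightarrow> Re z | Suc i \<Rightarrow> b i)"
    unfolding diagonalizes_def onb_def
  proof (intro conjI allI impI)
    fix i j assume ij: "i < Suc n" "j < Suc n"
    show "ip (Suc n) (u i) (u j) = (if i = j then 1 else 0)"
      using c ij v(1) by (cases i; cases j) (simp_all add: diagonalizes_def onb_def uu un u0 u0')
    show "sesq (Suc n) M (u i) (u j) =
        (if i = j then complex_of_real (case i of 0 \<Rightarrow> Re z | Suc i \<Rightarrow> b i) else 0)"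
      using c ij v(1) z
      by (cases i; cases j) (simp_all add: diagonalizes_def Mu un Mv Mu0' u0')
  qed
  then show ?case by blast
qed

section \<open>Relative entropy of mixtures\<close>

text \<open>Since \<open>-ln x\<close> is the integral of \<open>1/(x + s) - 1/(1 + s)\<close> over \<open>s > 0\<close>, a comparison of resolvents
  for all \<open>s\<close> yields one of logarithms.\<close>

lemma sum_ln_le_of_resolvent_le:
  fixes c x :: "'a \<Rightarrow> real" and l y :: "'b \<Rightarrow> real"
  assumes fin: "finite P" "finite Q"
    and x: "\<And>p. p \<in> P \<Longrightarrow> 0 < x p" and y: "\<And>q. q \<in> Q \<Longrightarrow> 0 < y q"
    and total: "sum c P = sum l Q"
    and le: "\<And>s. 0 < s \<Longrightarrow> (\<Sum>p\<in>P. c p / (x p + s)) \<le> (\<Sum>q\<in>Q. l q / (y q + s))"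
  shows "(\<Sum>q\<in>Q. l q * ln (y q)) \<le> (\<Sum>p\<in>P. c p * ln (x p))"
proof -
  \<comment> \<open>\<open>g\<close> is the claimed difference with all arguments shifted by
    \<open>s\<close>. The resolvent comparison makes it nonincreasing and it vanishes at infinity,
    so it is nonnegative, down to its limit \<open>g 0\<close>.\<close>
  define g where "g s = (\<Sum>p\<in>P. c p * ln (x p + s)) - (\<Sum>q\<in>Q. l q * ln (y q + s))" for s
  have deriv: "(g has_real_derivative
      (\<Sum>p\<in>P. c p / (x p + s)) - (\<Sum>q\<in>Q. l q / (y q + s))) (at s)" if "0 < s" for s
    unfolding g_def using x y that
    by (auto intro!: derivative_eq_intros sum.cong simp: add_pos_pos field_simps)
  have anti: "g t \<le> g s" if "0 < s" "s \<le> t" for s t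
    by (rule DERIV_nonpos_imp_nonincreasing[OF that(2)])
       (use deriv le that(1) in \<open>meson diff_le_0_iff_le less_le_trans\<close>)
  have ln_lim: "((\<lambda>s. ln (z + s) - ln s) \<longlongrightarrow> 0) at_top" if "0 < z" for z :: real
  proof -
    have "((\<lambda>s. ln (1 + z / s)) \<longlongrightarrow> ln (1 + 0)) at_top"
      by (intro tendsto_intros tendsto_divide_0[OF tendsto_const] filterlim_at_top_imp_at_infinity filterlim_ident) auto
    moreover have "\<forall>\<^sub>F s in at_top. ln (1 + z / s) = ln (z + s) - ln s"
      using eventually_gt_at_top[of 0]
    proof eventually_elim
      case (elim s)
      then have "1 + z / s = (z + s) / s" by (simp add: field_simps)
      then show ?case using elim that by (simp add: ln_div)
    qed
    ultimately show ?thesis by (simp add: tendsto_cong)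
  qed
  \<comment> \<open>Each logarithm alone diverges; subtracting \<open>ln s\<close> everywhere leaves
    \<open>g\<close> unchanged because both weight families have the same total.\<close>
  have "((\<lambda>s. (\<Sum>p\<in>P. c p * (ln (x p + s) - ln s)) - (\<Sum>q\<in>Q. l q * (ln (y q + s) - ln s)))
      \<longlongrightarrow> (\<Sum>p\<in>P. c p * 0) - (\<Sum>q\<in>Q. l q * 0)) at_top"
    by (intro tendsto_intros ln_lim x y)
  also have "(\<lambda>s. (\<Sum>p\<in>P. c p * (ln (x p + s) - ln s)) - (\<Sum>q\<in>Q. l q * (ln (y q + s) - ln s))) = g"
    using total by (simp add: g_def fun_eq_iff right_diff_distrib sum_subtractf flip: sum_distrib_right)
  finally have lim: "(g \<longlongrightarrow> 0) at_top" by simp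
  have nonneg: "0 \<le> g s" if "0 < s" for s
    by (rule tendsto_upperbound[OF lim])
       (use anti that in \<open>auto intro: eventually_mono[OF eventually_ge_at_top[of s]]\<close>)
  have "(g \<longlongrightarrow> g 0) (at_right 0)"
    unfolding g_def by (intro tendsto_intros) (use x y in \<open>auto simp: less_imp_neq[symmetric]\<close>)
  then have "0 \<le> g 0"
    by (rule tendsto_lowerbound) (use nonneg in \<open>auto simp: eventually_at_right_less intro: eventually_mono[OF eventually_at_right_less]\<close>)
  then show ?thesis by (simp add: g_def)
qed

lemma sesq_diff_self:
  assumes "hermitian n M"
  shows "Re (sesq n M (\<lambda>x. v x - complex_of_real c * w x) (\<lambda>x. v x - complex_of_real c * w x))
    = Re (sesq n M v v) - 2 * c * Re (sesq n M w v) + c\<^sup>2 * Re (sesq n M w w)"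
proof -
  \<comment> \<open>The difference is written as a combination indexed by \<open>bool\<close>, so
    that the sum rules for \<open>sesq\<close> apply.\<close>
  let ?C = "\<lambda>k::bool. if k then 1 else - complex_of_real c" and ?V = "\<lambda>k. if k then v else w"
  have e: "(\<lambda>x. v x - complex_of_real c * w x) = (\<lambda>x. \<Sum>k\<in>UNIV. ?C k * ?V k x)"
    by (simp add: UNIV_bool fun_eq_iff)
  have h: "Re (sesq n M v w) = Re (sesq n M w v)"
    using cnj_sesq[OF assms, of v w] by (metis complex_cnj(1) cnj.simps(1))
  show ?thesis
    unfolding e sesq_sum_left sesq_sum_right
    by (simp add: UNIV_bool h algebra_simps power2_eq_square)
qed

text \<open>The left-hand side is the supremum over \<open>X\<close> of
  \<open>2 Re Tr (A X) - Tr (X\<^sup>* B X) - s Tr (X A X\<^sup>*)\<close>, attained at the \<open>X\<close> chosen below. This expression is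
  linear in the pair \<open>(A, B)\<close>, so it splits over \<open>T j\<close>, and each summand is bounded by completing the
  square around the scalar \<open>l j / (mu j + s * l j)\<close>.\<close>

lemma resolvent_bound:
  fixes T :: "nat \<Rightarrow> nat \<Rightarrow> nat \<Rightarrow> complex" and l mu a b :: "nat \<Rightarrow> real"
  assumes T: "\<And>j. j < N \<Longrightarrow> positive n (T j)" and tr: "\<And>j. j < N \<Longrightarrow> (\<Sum>i<n. T j i i) = 1"
    and l: "\<And>j. j < N \<Longrightarrow> 0 \<le> l j" and mu: "\<And>j. j < N \<Longrightarrow> 0 < mu j" and s: "0 < s"
    and A: "diagonalizes n (\<lambda>x y. \<Sum>j<N. complex_of_real (l j) * T j x y) u a"
    and B: "diagonalizes n (\<lambda>x y. \<Sum>j<N. complex_of_real (mu j) * T j x y) v b"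
  shows "(\<Sum>i<n. \<Sum>k<n. (cmod (ip n (u i) (v k)))\<^sup>2 * ((a i)\<^sup>2 / (b k + s * a i)))
    \<le> (\<Sum>j<N. (l j)\<^sup>2 / (mu j + s * l j))"
proof -
  let ?A = "\<lambda>x y. \<Sum>j<N. complex_of_real (l j) * T j x y"
  let ?B = "\<lambda>x y. \<Sum>j<N. complex_of_real (mu j) * T j x y"
  define w where "w i k = (cmod (ip n (u i) (v k)))\<^sup>2" for i k
  define r where "r i k = a i / (b k + s * a i)" for i k
  \<comment> \<open>\<open>X i k\<close> is <v_k, X u_i>, so \<open>\<xi> i\<close> is X u_i and
    \<open>\<zeta> k\<close> is the adjoint of X applied to v_k. The factor \<open>r i k\<close>
    makes the quadratic expression in each entry stationary.\<close>
  define X where "X i k = complex_of_real (r i k) * ip n (v k) (u i)" for i k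
  define \<xi> where "\<xi> i = (\<lambda>x. \<Sum>k<n. X i k * v k x)" for i
  define \<zeta> where "\<zeta> k = (\<lambda>x. \<Sum>i<n. cnj (X i k) * u i x)" for k
  \<comment> \<open>With X' the adjoint of X, these are Tr (X' T_j X), Tr (X T_j X') and Re Tr (T_j
    X).\<close>
  define p where "p j = (\<Sum>i<n. Re (sesq n (T j) (\<xi> i) (\<xi> i)))" for j
  define q where "q j = (\<Sum>k<n. Re (sesq n (T j) (\<zeta> k) (\<zeta> k)))" for j
  define R where "R j = Re (\<Sum>i<n. \<Sum>k<n. X i k * sesq n (T j) (u i) (v k))" for j
  have u: "onb n u" and v: "onb n v" using A B by (auto simp: diagonalizes_def)
  have cX: "(cmod (X i k))\<^sup>2 = (r i k)\<^sup>2 * w i k" for i k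
    using cnj_ip[of n "u i" "v k"]
    by (simp add: X_def w_def norm_mult power_mult_distrib) (metis complex_mod_cnj)
  have trR: "(\<Sum>i<n. Re (sesq n (T j) (f i) (f i))) = 1" if "j < N" "onb n f" for j f
    using trace_sesq[OF that(2), of "T j"] tr[OF that(1)] by (metis Re_sum one_complex.simps(1))
  \<comment> \<open>Expands the nonnegative trace of (X - c)' T_j (X - c), using that T_j has trace
    1.\<close>
  have sqP: "0 \<le> p j - 2 * c * R j + c\<^sup>2" if j: "j < N" for j c
  proof -
    have h: "hermitian n (T j)" using T[OF j] by (simp add: positive_def)
    have "0 \<le> (\<Sum>i<n. Re (sesq n (T j) (\<lambda>x. \<xi> i x - complex_of_real c * u i x) (\<lambda>x. \<xi> i x - complex_of_real c * u i x)))"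
      using T[OF j] by (intro sum_nonneg) (simp add: positive_def)
    also have "\<dots> = p j - 2 * c * (\<Sum>i<n. Re (sesq n (T j) (u i) (\<xi> i))) + c\<^sup>2 * (\<Sum>i<n. Re (sesq n (T j) (u i) (u i)))"
      unfolding sesq_diff_self[OF h] p_def
      by (simp add: sum.distrib sum_subtractf sum_distrib_left)
    also have "(\<Sum>i<n. Re (sesq n (T j) (u i) (\<xi> i))) = R j"
      by (simp add: R_def \<xi>_def sesq_sum_right)
    finally show ?thesis using trR[OF j u] by simp
  qed
  \<comment> \<open>The same with X replaced by its adjoint; the cross term is again
    \<open>R j\<close> because T_j is hermitian.\<close>
  have sqQ: "0 \<le> q j - 2 * c * R j + c\<^sup>2" if j: "j < N" for j c
  proof -
    have h: "hermitian n (T j)" using T[OF j] by (simp add: positive_def)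
    have "0 \<le> (\<Sum>i<n. Re (sesq n (T j) (\<lambda>x. \<zeta> i x - complex_of_real c * v i x) (\<lambda>x. \<zeta> i x - complex_of_real c * v i x)))"
      using T[OF j] by (intro sum_nonneg) (simp add: positive_def)
    also have "\<dots> = q j - 2 * c * (\<Sum>i<n. Re (sesq n (T j) (v i) (\<zeta> i))) + c\<^sup>2 * (\<Sum>i<n. Re (sesq n (T j) (v i) (v i)))"
      unfolding sesq_diff_self[OF h] q_def
      by (simp add: sum.distrib sum_subtractf sum_distrib_left)
    also have "(\<Sum>i<n. Re (sesq n (T j) (v i) (\<zeta> i))) = (\<Sum>i<n. Re (sesq n (T j) (\<zeta> i) (v i)))"
      using cnj_sesq[OF h] by (metis cnj.simps(1))
    also have "\<dots> = R j"
      unfolding R_def \<zeta>_def sesq_sum_left Re_sum complex_cnj_cnj by (rule sum.swap)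
    finally show ?thesis using trR[OF j v] by simp
  qed
  have sesqA: "sesq n ?A y z = (\<Sum>j<N. complex_of_real (l j) * sesq n (T j) y z)" for y z
    by (rule sesq_sum_matrix)
  have sesqB: "sesq n ?B y z = (\<Sum>j<N. complex_of_real (mu j) * sesq n (T j) y z)" for y z
    by (rule sesq_sum_matrix)
  \<comment> \<open>Weighted by \<open>mu\<close>, the \<open>p j\<close> add up to Tr (X' B X),
    evaluated in the eigenbasis of B. \<open>sumQ\<close> and \<open>sumR\<close> treat Tr (X A X')
    and Re Tr (A X) through the eigenbasis of A.\<close>
  have sumP: "(\<Sum>j<N. mu j * p j) = (\<Sum>i<n. \<Sum>k<n. b k * ((r i k)\<^sup>2 * w i k))"
  proof -
    have "(\<Sum>j<N. mu j * p j) = (\<Sum>i<n. \<Sum>j<N. mu j * Re (sesq n (T j) (\<xi> i) (\<xi> i)))"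
      unfolding p_def sum_distrib_left by (rule sum.swap)
    also have "\<dots> = (\<Sum>i<n. Re (sesq n ?B (\<xi> i) (\<xi> i)))"
      by (simp add: sesqB)
    also have "\<dots> = (\<Sum>i<n. \<Sum>k<n. b k * (cmod (ip n (v k) (\<xi> i)))\<^sup>2)"
      by (simp add: sesq_diagonal_expansion[OF B] flip: of_real_power of_real_mult of_real_sum)
    also have "\<dots> = (\<Sum>i<n. \<Sum>k<n. b k * (cmod (X i k))\<^sup>2)"
    proof (intro sum.cong refl)
      fix i k assume "k \<in> {..<n}"
      then have "ip n (v k) (\<xi> i) = (\<Sum>k'<n. if k = k' then X i k' else 0)"
        unfolding \<xi>_def ip_sum_right using v by (intro sum.cong refl) (auto simp: onb_def)
      then show "b k * (cmod (ip n (v k) (\<xi> i)))\<^sup>2 = b k * (cmod (X i k))\<^sup>2"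
        using \<open>k \<in> {..<n}\<close> by simp
    qed
    finally show ?thesis by (simp add: cX)
  qed
  have sumQ: "(\<Sum>j<N. l j * q j) = (\<Sum>i<n. \<Sum>k<n. a i * ((r i k)\<^sup>2 * w i k))"
  proof -
    have "(\<Sum>j<N. l j * q j) = (\<Sum>k<n. \<Sum>j<N. l j * Re (sesq n (T j) (\<zeta> k) (\<zeta> k)))"
      unfolding q_def sum_distrib_left by (rule sum.swap)
    also have "\<dots> = (\<Sum>k<n. Re (sesq n ?A (\<zeta> k) (\<zeta> k)))"
      by (simp add: sesqA)
    also have "\<dots> = (\<Sum>k<n. \<Sum>i<n. a i * (cmod (ip n (u i) (\<zeta> k)))\<^sup>2)"
      by (simp add: sesq_diagonal_expansion[OF A] flip: of_real_power of_real_mult of_real_sum)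
    also have "\<dots> = (\<Sum>k<n. \<Sum>i<n. a i * (cmod (X i k))\<^sup>2)"
    proof (intro sum.cong refl)
      fix i k assume "i \<in> {..<n}"
      then have "ip n (u i) (\<zeta> k) = (\<Sum>i'<n. if i = i' then cnj (X i' k) else 0)"
        unfolding \<zeta>_def ip_sum_right using u by (intro sum.cong refl) (auto simp: onb_def)
      then show "a i * (cmod (ip n (u i) (\<zeta> k)))\<^sup>2 = a i * (cmod (X i k))\<^sup>2"
        using \<open>i \<in> {..<n}\<close> by simp
    qed
    also have "\<dots> = (\<Sum>i<n. \<Sum>k<n. a i * (cmod (X i k))\<^sup>2)" by (rule sum.swap)
    finally show ?thesis by (simp add: cX)
  qed
  have sumR: "(\<Sum>j<N. l j * R j) = (\<Sum>i<n. \<Sum>k<n. a i * r i k * w i k)"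
  proof -
    have "(\<Sum>j<N. l j * R j) = (\<Sum>j<N. \<Sum>i<n. \<Sum>k<n. Re (X i k * (l j * sesq n (T j) (u i) (v k))))"
      by (simp add: R_def sum_distrib_left algebra_simps)
    also have "\<dots> = (\<Sum>i<n. \<Sum>j<N. \<Sum>k<n. Re (X i k * (l j * sesq n (T j) (u i) (v k))))"
      by (rule sum.swap)
    also have "\<dots> = (\<Sum>i<n. \<Sum>k<n. \<Sum>j<N. Re (X i k * (l j * sesq n (T j) (u i) (v k))))"
      by (intro sum.cong refl sum.swap)
    also have "\<dots> = (\<Sum>i<n. \<Sum>k<n. Re (X i k * sesq n ?A (u i) (v k)))"
      unfolding sesqA sum_distrib_left Re_sum ..
    also have "\<dots> = (\<Sum>i<n. \<Sum>k<n. a i * r i k * w i k)"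
    proof (intro sum.cong refl)
      fix i k assume "i \<in> {..<n}"
      then have "X i k * sesq n ?A (u i) (v k) = complex_of_real (a i * r i k) * (ip n (u i) (v k) * cnj (ip n (u i) (v k)))"
        by (simp add: X_def sesq_eigen_left[OF A] cnj_ip)
      also have "\<dots> = complex_of_real (a i * r i k * w i k)"
        by (simp add: w_def complex_norm_square del: of_real_power)
      finally show "Re (X i k * sesq n ?A (u i) (v k)) = a i * r i k * w i k" by simp
    qed
    finally show ?thesis .
  qed
  have sq: "0 \<le> mu j * p j + s * (l j * q j) - 2 * (l j * R j) + (l j)\<^sup>2 / (mu j + s * l j)"
    if j: "j < N" for j
  proof -
    define t where "t = l j / (mu j + s * l j)"
    have "0 < mu j + s * l j" using mu[OF j] l[OF j] s by (intro add_pos_nonneg) auto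
    then have t: "t * (mu j + s * l j) = l j" by (simp add: t_def)
    \<comment> \<open>Both squares are used at the same scalar \<open>t\<close>, chosen so that the
      total coefficient of \<open>R j\<close> becomes \<open>- 2 * l j\<close>.\<close>
    have "0 \<le> mu j * (p j - 2 * t * R j + t\<^sup>2) + s * l j * (q j - 2 * t * R j + t\<^sup>2)"
      using sqP[OF j, of t] sqQ[OF j, of t] mu[OF j] l[OF j] s
      by (intro add_nonneg_nonneg[OF mult_nonneg_nonneg mult_nonneg_nonneg]) auto
    also have "\<dots> = mu j * p j + s * (l j * q j) - 2 * (t * (mu j + s * l j)) * R j + t * (t * (mu j + s * l j))"
      by (simp add: algebra_simps power2_eq_square)
    also have "\<dots> = mu j * p j + s * (l j * q j) - 2 * (l j * R j) + (l j)\<^sup>2 / (mu j + s * l j)"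
      unfolding t by (simp add: t_def power2_eq_square)
    finally show ?thesis .
  qed
  have "0 \<le> (\<Sum>j<N. mu j * p j + s * (l j * q j) - 2 * (l j * R j) + (l j)\<^sup>2 / (mu j + s * l j))"
    using sq by (intro sum_nonneg) auto
  also have "\<dots> = (\<Sum>j<N. mu j * p j) + s * (\<Sum>j<N. l j * q j) - 2 * (\<Sum>j<N. l j * R j)
      + (\<Sum>j<N. (l j)\<^sup>2 / (mu j + s * l j))"
    by (simp add: sum.distrib sum_subtractf sum_distrib_left)
  also have "(\<Sum>j<N. mu j * p j) + s * (\<Sum>j<N. l j * q j) - 2 * (\<Sum>j<N. l j * R j)
      = (\<Sum>i<n. \<Sum>k<n. b k * ((r i k)\<^sup>2 * w i k) + s * (a i * ((r i k)\<^sup>2 * w i k)) - 2 * (a i * r i k * w i k))"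
    unfolding sumP sumQ sumR by (simp add: sum.distrib sum_subtractf sum_distrib_left)
  \<comment> \<open>If \<open>b k + s * a i\<close> is 0, then \<open>r i k\<close> is 0 by the
    convention on division and both sides vanish.\<close>
  also have "\<dots> = (\<Sum>i<n. \<Sum>k<n. - (w i k * ((a i)\<^sup>2 / (b k + s * a i))))"
    by (intro sum.cong refl) (simp add: r_def divide_simps power2_eq_square, simp add: algebra_simps)
  finally show ?thesis by (simp add: w_def sum_negf)
qed

section \<open>Eigenvalues of mixtures and entropy under state preparation\<close>

lemma eigenvalue_nonneg:
  assumes "positive n M" "diagonalizes n M u a" "i < n"
  shows "0 \<le> a i"
  using assms by (auto simp: positive_def diagonalizes_def dest!: spec[of _ i] spec[of _ "u i"])

lemma sum_eigenvalues:
  assumes "diagonalizes n M u a"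
  shows "complex_of_real (\<Sum>i<n. a i) = (\<Sum>i<n. M i i)"
  using assms trace_sesq[of n u M] by (simp add: diagonalizes_def)

lemma positive_combination:
  assumes "\<And>j. j < N \<Longrightarrow> positive n (T j)" "\<And>j. j < N \<Longrightarrow> 0 \<le> l j"
  shows "positive n (\<lambda>x y. \<Sum>j<N. complex_of_real (l j) * T j x y)"
  unfolding positive_def
proof (intro conjI allI)
  show "hermitian n (\<lambda>x y. \<Sum>j<N. complex_of_real (l j) * T j x y)"
    using assms(1) unfolding positive_def hermitian_def cnj_sum complex_cnj_mult complex_cnj_complex_of_real
    by (intro allI impI sum.cong refl arg_cong2[where f = times]) blast
  show "0 \<le> Re (sesq n (\<lambda>x y. \<Sum>j<N. complex_of_real (l j) * T j x y) v v)" for v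
    using assms by (auto simp: sesq_sum_matrix positive_def intro!: sum_nonneg)
qed

text \<open>This is the inequality \<open>S(A || B) \<le> D(l || mu)\<close>, with the cross term \<open>Tr (A log B)\<close>
  evaluated in the eigenbasis of \<open>B\<close>; \<open>ln 0 = 0\<close> is harmless as the kernel of \<open>B\<close> is contained in that of \<open>A\<close>.\<close>

lemma entropy_preparation_bound:
  fixes T :: "nat \<Rightarrow> nat \<Rightarrow> nat \<Rightarrow> complex" and l mu a b :: "nat \<Rightarrow> real" and N :: nat
  defines "M \<equiv> \<lambda>x y. \<Sum>j<N. complex_of_real (l j) * T j x y"
  assumes T: "\<And>j. j < N \<Longrightarrow> positive n (T j)" and tr: "\<And>j. j < N \<Longrightarrow> (\<Sum>i<n. T j i i) = 1"
    and l: "\<And>j. j < N \<Longrightarrow> 0 \<le> l j" and mu: "\<And>j. j < N \<Longrightarrow> 0 < mu j"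
    and A: "diagonalizes n M u a"
    and B: "diagonalizes n (\<lambda>x y. \<Sum>j<N. complex_of_real (mu j) * T j x y) v b"
  shows "(\<Sum>j<N. eta (l j)) + (\<Sum>j<N. l j * ln (mu j))
    \<le> (\<Sum>i<n. eta (a i)) + (\<Sum>k<n. Re (sesq n M (v k) (v k)) * ln (b k))"
proof -
  let ?B = "\<lambda>x y. \<Sum>j<N. complex_of_real (mu j) * T j x y"
  define w where "w i k = (cmod (ip n (u i) (v k)))\<^sup>2" for i k
  \<comment> \<open>The weights \<open>c\<close> of eigenvector pairs and the eigenvalue ratios
    \<open>x\<close> give -S(A || B) as the sum of \<open>c p * ln (x p)\<close>; \<open>l\<close>
    and \<open>y\<close> give -D(l || mu) likewise. The value 1 at vanishing weights keeps the
    arguments of the logarithm positive.\<close>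
  define c where "c = (\<lambda>(i, k). w i k * a i)"
  define x where "x = (\<lambda>(i, k). if w i k * a i = 0 then 1 else b k / a i)"
  define y where "y j = (if l j = 0 then 1 else mu j / l j)" for j
  have u: "onb n u" and v: "onb n v" using A B by (auto simp: diagonalizes_def)
  have a: "0 \<le> a i" if "i < n" for i
    using eigenvalue_nonneg[OF positive_combination[OF T l] A[unfolded M_def] that] .
  have b: "0 \<le> b k" if "k < n" for k
    using eigenvalue_nonneg[OF positive_combination[OF T less_imp_le[OF mu]] B that] .
  have w0: "0 \<le> w i k" for i k by (simp add: w_def)
  have diag: "Re (sesq n M (v k) (v k)) = (\<Sum>i<n. w i k * a i)" for k
    by (simp add: sesq_diagonal_expansion[OF A] w_def mult.commute flip: of_real_power of_real_mult of_real_sum)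
  have w1: "(\<Sum>k<n. w i k) = 1" if "i < n" for i
  proof -
    have "complex_of_real (\<Sum>k<n. w i k) = (\<Sum>k<n. ip n (u i) (v k) * ip n (v k) (u i))"
      by (simp add: w_def complex_norm_square cnj_ip del: of_real_power)
    also have "\<dots> = 1" using parseval[OF v, of "u i" "u i"] u that by (simp add: onb_def)
    finally show ?thesis using of_real_eq_1_iff by blast
  qed
  \<comment> \<open>If \<open>b k = 0\<close>, then v_k has zero expectation in every
    \<open>T j\<close>, as all \<open>mu j\<close> are positive, and hence in \<open>M\<close>; so
    no pair with that \<open>k\<close> carries weight.\<close>
  have bpos: "0 < b k" if "i < n" "k < n" "w i k * a i \<noteq> 0" for i k
  proof (rule ccontr)
    assume "\<not> 0 < b k"
    then have "b k = 0" using b[OF that(2)] by simp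
    then have "sesq n ?B (v k) (v k) = 0" using B that(2) by (simp add: diagonalizes_def)
    then have "(\<Sum>j<N. mu j * Re (sesq n (T j) (v k) (v k))) = 0"
      by (simp add: sesq_sum_matrix complex_eq_iff)
    then have z: "\<forall>j<N. mu j * Re (sesq n (T j) (v k) (v k)) = 0"
      using T mu by (subst (asm) sum_nonneg_eq_0_iff) (auto simp: positive_def less_imp_le)
    have "Re (sesq n (T j) (v k) (v k)) = 0" if "j < N" for j
      using z mu[OF that] that by auto
    then have "Re (sesq n M (v k) (v k)) = 0"
      by (simp add: M_def sesq_sum_matrix)
    then have "\<forall>i<n. w i k * a i = 0"
      unfolding diag using a w0 by (subst (asm) sum_nonneg_eq_0_iff) auto
    then show False using that by blast
  qed
  have "(\<Sum>j<N. l j * ln (y j)) \<le> (\<Sum>p\<in>{..<n} \<times> {..<n}. c p * ln (x p))"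
  proof (rule sum_ln_le_of_resolvent_le)
    show "0 < x p" if "p \<in> {..<n} \<times> {..<n}" for p
      using that bpos a by (fastforce simp: x_def order.strict_iff_order)
    show "0 < y j" if "j \<in> {..<N}" for j
      using that l[of j] mu[of j] by (auto simp: y_def)
    \<comment> \<open>Both totals are the trace of \<open>M\<close>: through its eigenvalues on one
      side, through the unit traces of the \<open>T j\<close> on the other.\<close>
    have "sum c ({..<n} \<times> {..<n}) = (\<Sum>i<n. (\<Sum>k<n. w i k) * a i)"
      by (simp add: c_def sum_distrib_right flip: sum.cartesian_product)
    also have "\<dots> = (\<Sum>i<n. a i)" using w1 by simp
    also have "complex_of_real \<dots> = (\<Sum>i<n. \<Sum>j<N. l j * T j i i)"
      using sum_eigenvalues[OF A] by (simp add: M_def)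
    also have "\<dots> = (\<Sum>j<N. l j * (\<Sum>i<n. T j i i))"
      unfolding sum_distrib_left by (rule sum.swap)
    also have "\<dots> = complex_of_real (sum l {..<N})" using tr by simp
    finally show "sum c ({..<n} \<times> {..<n}) = sum l {..<N}" using of_real_eq_iff by blast
    fix s :: real assume s: "0 < s"
    have "(\<Sum>p\<in>{..<n} \<times> {..<n}. c p / (x p + s)) = (\<Sum>i<n. \<Sum>k<n. w i k * ((a i)\<^sup>2 / (b k + s * a i)))"
      unfolding sum.cartesian_product
    proof (intro sum.cong refl, clarify)
      fix i k assume ik: "i < n" "k < n"
      show "c (i, k) / (x (i, k) + s) = w i k * ((a i)\<^sup>2 / (b k + s * a i))"
      proof (cases "w i k * a i = 0")
        case False
        then have "0 < a i" using a[OF ik(1)] by auto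
        then show ?thesis using False by (simp add: c_def x_def field_simps power2_eq_square)
      qed (auto simp: c_def)
    qed
    also have "\<dots> \<le> (\<Sum>j<N. (l j)\<^sup>2 / (mu j + s * l j))"
      unfolding w_def by (rule resolvent_bound[OF T tr l mu s A[unfolded M_def] B])
    also have "\<dots> = (\<Sum>j<N. l j / (y j + s))"
      by (intro sum.cong refl) (auto simp: y_def field_simps power2_eq_square)
    finally show "(\<Sum>p\<in>{..<n} \<times> {..<n}. c p / (x p + s)) \<le> (\<Sum>j<N. l j / (y j + s))" .
  qed auto
  moreover have "(\<Sum>j<N. l j * ln (y j)) = (\<Sum>j<N. eta (l j)) + (\<Sum>j<N. l j * ln (mu j))"
    unfolding sum.distrib[symmetric]
  proof (intro sum.cong refl)
    fix j assume "j \<in> {..<N}"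
    then show "l j * ln (y j) = eta (l j) + l j * ln (mu j)"
      using l[of j] mu[of j] by (auto simp: y_def eta_def ln_div algebra_simps)
  qed
  moreover have "(\<Sum>p\<in>{..<n} \<times> {..<n}. c p * ln (x p))
      = (\<Sum>i<n. eta (a i)) + (\<Sum>k<n. Re (sesq n M (v k) (v k)) * ln (b k))"
  proof -
    have "(\<Sum>p\<in>{..<n} \<times> {..<n}. c p * ln (x p)) = (\<Sum>i<n. \<Sum>k<n. w i k * eta (a i) + w i k * a i * ln (b k))"
      unfolding sum.cartesian_product
    proof (intro sum.cong refl, clarify)
      fix i k assume ik: "i < n" "k < n"
      show "c (i, k) * ln (x (i, k)) = w i k * eta (a i) + w i k * a i * ln (b k)"
      proof (cases "w i k * a i = 0")
        case False
        then have "0 < a i" "0 < b k" using a[OF ik(1)] bpos[OF ik] by auto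
        then show ?thesis using False by (simp add: c_def x_def eta_def ln_div algebra_simps)
      qed (auto simp: c_def eta_def)
    qed
    also have "\<dots> = (\<Sum>i<n. (\<Sum>k<n. w i k) * eta (a i)) + (\<Sum>i<n. \<Sum>k<n. w i k * a i * ln (b k))"
      by (simp add: sum.distrib sum_distrib_right)
    also have "(\<Sum>i<n. \<Sum>k<n. w i k * a i * ln (b k)) = (\<Sum>k<n. Re (sesq n M (v k) (v k)) * ln (b k))"
      unfolding diag sum_distrib_right by (rule sum.swap)
    finally show ?thesis using w1 by simp
  qed
  ultimately show ?thesis by simp
qed

section \<open>States, entropy and channels as matrices\<close>

abbreviation entries :: "complex mat \<Rightarrow> nat \<Rightarrow> nat \<Rightarrow> complex" where
  "entries A \<equiv> \<lambda>i j. A $$ (i, j)"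

section \<open>Density matrices and their entropy in terms of forms\<close>

lemma cinner_mult_mat_vec:
  assumes "A \<in> carrier_mat n n" "v \<in> carrier_vec n"
  shows "cinner v (A *\<^sub>v v) = sesq n (entries A) (($) v) (($) v)"
  using assms
  by (simp add: cinner_def sesq_as_ip ip_def scalar_prod_def lessThan_atLeast0)

lemma psd_iff_positive:
  "psd n A \<longleftrightarrow> A \<in> carrier_mat n n \<and> positive n (entries A)"
proof (cases "A \<in> carrier_mat n n")
  case True
  have herm: "cadj A = A \<longleftrightarrow> hermitian n (entries A)"
  proof
    assume h: "cadj A = A"
    have "A $$ (i, j) = cnj (A $$ (j, i))" if "i < n" "j < n" for i j
      by (subst h[symmetric]) (use True that in \<open>simp add: cadj_def\<close>)
    then show "hermitian n (entries A)" unfolding hermitian_def by blast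
  next
    assume h: "hermitian n (entries A)"
    have "cnj (A $$ (j, i)) = A $$ (i, j)" if "i < n" "j < n" for i j
      using h that unfolding hermitian_def by metis
    then show "cadj A = A" using True unfolding cadj_def by (intro eq_matI) auto
  qed
  have vec: "(\<forall>v \<in> carrier_vec n. cinner v (A *\<^sub>v v) \<in> \<real> \<and> Re (cinner v (A *\<^sub>v v)) \<ge> 0)
      \<longleftrightarrow> (\<forall>v. 0 \<le> Re (sesq n (entries A) v v))" if h: "hermitian n (entries A)"
  proof -
    have r: "sesq n (entries A) v v \<in> \<real>" for v
      using cnj_sesq[OF h, of v v] by (simp add: Reals_cnj_iff)
    have "sesq n (entries A) (($) (vec n v)) (($) (vec n v)) = sesq n (entries A) v v" for v
      by (rule sesq_cong) auto
    then show ?thesis using r by (metis True cinner_mult_mat_vec vec_carrier)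
  qed
  show ?thesis unfolding psd_def positive_def using True herm vec by blast
qed (simp add: psd_def)

lemma density_iff:
  "A \<in> density n \<longleftrightarrow> A \<in> carrier_mat n n \<and> positive n (entries A) \<and> (\<Sum>i<n. A $$ (i, i)) = 1"
  by (auto simp: density_def psd_iff_positive ctrace_def)

text \<open>The eigenbasis gives a unitary similarity to a diagonal matrix, so the roots of the
  characteristic polynomial, by which \<open>vN_entropy\<close> is defined, are the
  \<open>a i\<close> with multiplicity.\<close>

lemma vN_entropy_eq_sum_eta:
  assumes A: "A \<in> carrier_mat n n" and diag: "diagonalizes n (entries A) u a"
  shows "vN_entropy A = (\<Sum>i<n. eta (a i))"
proof -
  let ?U = "mat n n (\<lambda>(i, j). u j i)" and ?V = "mat n n (\<lambda>(i, j). cnj (u i j))"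
  let ?D = "mat n n (\<lambda>(i, j). if i = j then complex_of_real (a i) else 0)"
  have u: "onb n u" using diag by (simp add: diagonalizes_def)
  have VU: "?V * ?U = 1\<^sub>m n"
    by (rule eq_matI) (use u in \<open>auto simp: onb_def ip_def scalar_prod_def lessThan_atLeast0\<close>)
  then have UV: "?U * ?V = 1\<^sub>m n"
    using mat_mult_left_right_inverse[of ?V n ?U] by simp
  have "?V * (A * ?U) = ?D"
  proof (rule eq_matI)
    fix i j assume ij: "i < dim_row ?D" "j < dim_col ?D"
    then have "(?V * (A * ?U)) $$ (i, j) = sesq n (entries A) (u i) (u j)"
      using A by (simp add: sesq_as_ip ip_def scalar_prod_def lessThan_atLeast0)
    then show "(?V * (A * ?U)) $$ (i, j) = ?D $$ (i, j)"
      using diag ij by (simp add: diagonalizes_def)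
  qed (use A in auto)
  then have D: "?D = ?V * A * ?U" using A by (simp add: assoc_mult_mat[of _ n n _ n _ n])
  have "similar_mat ?D A"
    unfolding similar_mat_def similar_mat_wit_def Let_def
    by (rule exI[of _ ?V], rule exI[of _ ?U]) (use A VU UV D in auto)
  then have "char_poly A = char_poly ?D" by (simp add: char_poly_similar)
  also have "\<dots> = (\<Prod>z\<leftarrow>diag_mat ?D. [:- z, 1:])"
    by (rule char_poly_upper_triangular[of _ n]) (auto simp: upper_triangular_def)
  also have "diag_mat ?D = map (\<lambda>i. complex_of_real (a i)) [0..<n]"
    by (auto simp: diag_mat_def)
  finally have "char_poly A = (\<Prod>i\<leftarrow>[0..<n]. [:- complex_of_real (a i), 1:])"
    by (simp add: o_def)
  then have "char_poly A = (\<Prod>i<n. [:- complex_of_real (a i), 1:])"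
    by (simp add: interv_sum_list_conv_sum_set_nat prod.list_conv_set_nth lessThan_atLeast0 flip: prod.distinct_set_conv_list)
  then have "proots (char_poly A) = (\<Sum>i<n. {#complex_of_real (a i)#})"
    by (simp add: proots_prod)
  moreover have "\<Sum>\<^sub># (image_mset (\<lambda>z. eta (Re z)) (\<Sum>i<k. {#complex_of_real (a i)#})) = (\<Sum>i<k. eta (a i))" for k
    by (induction k) simp_all
  ultimately show ?thesis by (simp add: vN_entropy_def)
qed

lemma eta_nonneg: "0 \<le> x \<Longrightarrow> x \<le> 1 \<Longrightarrow> 0 \<le> eta x"
  by (auto simp: eta_def mult_nonneg_nonpos)

lemma vN_entropy_nonneg:
  assumes "A \<in> density n"
  shows "0 \<le> vN_entropy A"
proof -
  have A: "A \<in> carrier_mat n n" "positive n (entries A)" "(\<Sum>i<n. A $$ (i, i)) = 1"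
    using assms by (auto simp: density_iff)
  then obtain u a where d: "diagonalizes n (entries A) u a"
    using spectral_theorem unfolding positive_def by blast
  have "complex_of_real (\<Sum>i<n. a i) = 1" using sum_eigenvalues[OF d] A by simp
  then have s: "(\<Sum>i<n. a i) = 1" using of_real_eq_1_iff by blast
  have a: "0 \<le> a i" if "i < n" for i using eigenvalue_nonneg[OF A(2) d that] .
  have "a i \<le> 1" if "i < n" for i
    using member_le_sum[of i "{..<n}" a] a s that by auto
  then show ?thesis using a
    by (auto simp: vN_entropy_eq_sum_eta[OF A(1) d] intro!: sum_nonneg eta_nonneg)
qed

text \<open>\<open>Inf\<close> of a set of reals lies below its members once the set is bounded
  below; 0 is a bound since entropies of the output states are nonnegative.\<close>

lemma H_chan_le:
  assumes chan: "\<And>\<sigma>. \<sigma> \<in> density n \<Longrightarrow> \<Psi> \<sigma> \<in> density n'"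
    and \<pi>: "\<And>j. j < N \<Longrightarrow> 0 \<le> \<pi> j" "(\<Sum>j<N. \<pi> j) = 1"
    and \<sigma>s: "\<And>j. j < N \<Longrightarrow> \<sigma>s j \<in> density n"
    and \<sigma>: "\<sigma> = msum n N (\<lambda>j. complex_of_real (\<pi> j) \<cdot>\<^sub>m \<sigma>s j)"
  shows "H_chan n \<Psi> \<sigma> \<le> (\<Sum>j<N. \<pi> j * vN_entropy (\<Psi> (\<sigma>s j)))"
  unfolding H_chan_def
proof (rule cInf_lower)
  show "bdd_below {(\<Sum>j<N. \<pi> j * vN_entropy (\<Psi> (\<sigma>s j))) | N \<pi> \<sigma>s.
      (\<forall>j<N. \<pi> j \<ge> 0 \<and> \<sigma>s j \<in> density n) \<and> (\<Sum>j<N. \<pi> j) = 1 \<and>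
      \<sigma> = msum n N (\<lambda>j. complex_of_real (\<pi> j) \<cdot>\<^sub>m \<sigma>s j)}"
    using chan by (intro bdd_belowI[of _ 0]) (auto intro!: sum_nonneg mult_nonneg_nonneg vN_entropy_nonneg)
qed (use \<pi> \<sigma>s \<sigma> in blast)

section \<open>Bipartite indices, linear maps and channels\<close>

lemma sum_bipartite:
  fixes f :: "nat \<Rightarrow> 'a::comm_monoid_add"
  shows "(\<Sum>i<d * m. f i) = (\<Sum>a<d. \<Sum>b<m. f (a * m + b))"
proof -
  have "(\<Sum>i<d * m. f i) = (\<Sum>a<d. sum f {a * m..<a * m + m})"
    by (rule sum.nat_group[symmetric])
  moreover have "sum f {a * m..<a * m + m} = (\<Sum>b<m. f (a * m + b))" for a
    using sum.shift_bounds_nat_ivl[of f 0 "a * m" m]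
    by (simp add: lessThan_atLeast0 add.commute)
  ultimately show ?thesis by simp
qed

lemma bipartite_less: "a < d \<Longrightarrow> b < m \<Longrightarrow> a * m + b < d * (m::nat)"
proof -
  assume "a < d" "b < m"
  then have "a * m + b < Suc a * m" "Suc a * m \<le> d * m" by (simp, intro mult_le_mono1, simp)
  then show "a * m + b < d * m" by linarith
qed

lemma linear_map_on_sum:
  assumes lin: "linear_map_on n \<Omega>" and "finite K" and "\<And>k. k \<in> K \<Longrightarrow> F k \<in> carrier_mat n n"
  shows "\<Omega> (mat n n (\<lambda>(i, j). \<Sum>k\<in>K. c k * F k $$ (i, j)))
       = mat n n (\<lambda>(i, j). \<Sum>k\<in>K. c k * \<Omega> (F k) $$ (i, j))"
  using assms(2,3)
proof (induction K rule: finite_induct)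
  case empty
  \<comment> \<open>The empty sum requires that \<open>\<Omega>\<close> fix the zero matrix, which
    is homogeneity with the scalar 0.\<close>
  have "\<Omega> (0\<^sub>m n n) \<in> carrier_mat n n" using lin by (simp add: linear_map_on_def)
  moreover have "\<Omega> (0 \<cdot>\<^sub>m 0\<^sub>m n n) = 0 \<cdot>\<^sub>m \<Omega> (0\<^sub>m n n)"
    using lin unfolding linear_map_on_def by (metis zero_carrier_mat)
  moreover have "0 \<cdot>\<^sub>m 0\<^sub>m n n = (0\<^sub>m n n :: complex mat)" by (intro eq_matI) auto
  moreover have "0 \<cdot>\<^sub>m A = 0\<^sub>m n n" if "A \<in> carrier_mat n n" for A :: "complex mat"
    using that by (intro eq_matI) auto
  ultimately have "\<Omega> (0\<^sub>m n n) = 0\<^sub>m n n" by metis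
  then show ?case by (simp add: zero_mat_def)
next
  case (insert k K)
  let ?S = "mat n n (\<lambda>(i, j). \<Sum>k\<in>K. c k * F k $$ (i, j))"
  have F: "F k \<in> carrier_mat n n" using insert by simp
  have OF: "\<Omega> (F k) \<in> carrier_mat n n" using lin F by (simp add: linear_map_on_def)
  have "mat n n (\<lambda>(i, j). \<Sum>k\<in>insert k K. c k * F k $$ (i, j)) = c k \<cdot>\<^sub>m F k + ?S"
    using insert.hyps F by (intro eq_matI) auto
  then have "\<Omega> (mat n n (\<lambda>(i, j). \<Sum>k\<in>insert k K. c k * F k $$ (i, j))) = c k \<cdot>\<^sub>m \<Omega> (F k) + \<Omega> ?S"
    using lin F by (simp add: linear_map_on_def)
  also have "\<Omega> ?S = mat n n (\<lambda>(i, j). \<Sum>k\<in>K. c k * \<Omega> (F k) $$ (i, j))"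
    using insert by blast
  finally show ?case using insert.hyps OF by (intro eq_matI) auto
qed

text \<open>Complete positivity with a one-dimensional ancilla is plain positivity, since
  \<open>right_apply 1 m \<Omega>\<close> acts as \<open>\<Omega>\<close>.\<close>

lemma quantum_channel_density:
  assumes "quantum_channel m \<Omega>" "\<sigma> \<in> density m"
  shows "\<Omega> \<sigma> \<in> density m"
proof -
  have \<sigma>: "\<sigma> \<in> carrier_mat m m" "psd m \<sigma>" "ctrace \<sigma> = 1"
    using assms(2) by (auto simp: density_def psd_def)
  have O: "\<Omega> \<sigma> \<in> carrier_mat m m"
    using assms(1) \<sigma>(1) by (simp add: quantum_channel_def linear_map_on_def)
  have "mat m m (\<lambda>(x, y). \<sigma> $$ (x, y)) = \<sigma>" using \<sigma>(1) by (intro eq_matI) auto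
  then have "right_apply 1 m \<Omega> \<sigma> = \<Omega> \<sigma>"
    unfolding right_apply_def using O by (intro eq_matI) auto
  moreover have "psd (1 * m) (right_apply 1 m \<Omega> \<sigma>)"
    using assms(1) \<sigma>(2) unfolding quantum_channel_def completely_positive_def by (metis mult_1)
  moreover have "ctrace (\<Omega> \<sigma>) = 1"
    using assms(1) \<sigma> by (simp add: quantum_channel_def trace_preserving_def)
  ultimately show ?thesis by (simp add: density_def)
qed

section \<open>The phase damping channel\<close>

definition phase :: "nat \<Rightarrow> nat \<Rightarrow> complex" where
  "phase d s = exp (\<i> * complex_of_real (2 * pi * real s / real d))"

section \<open>Roots of unity and character sums\<close>

lemma phase_cis: "phase d s = cis (2 * pi * real s / real d)"
  by (simp add: phase_def cis_conv_exp)

lemma phase_cnj: "phase d s * cnj (phase d s) = 1"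
  by (simp add: phase_cis cis_cnj cis_mult)

text \<open>The angle 2 pi s j / d is symmetric in \<open>s\<close> and \<open>j\<close>. This turns
  a sum over the basis index into the sum over exponents of \<open>sum_phase_powers\<close>.\<close>

lemma phase_power_comm: "phase d s ^ j = phase d j ^ s"
  by (simp add: phase_cis DeMoivre mult_ac)

text \<open>Orthogonality of the characters of the cyclic group: for distinct \<open>s\<close> and
  \<open>t\<close> the ratio \<open>?q\<close> is a d-th root of unity other than 1, and its
  geometric sum vanishes.\<close>

lemma sum_phase_powers:
  assumes "s < d" "t < d"
  shows "(\<Sum>j<d. phase d s ^ j * cnj (phase d t ^ j)) = (if s = t then of_nat d else 0)"
proof -
  let ?q = "phase d s * cnj (phase d t)"
  have e: "(\<Sum>j<d. phase d s ^ j * cnj (phase d t ^ j)) = (\<Sum>j<d. ?q ^ j)"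
    by (simp add: power_mult_distrib)
  have pd: "phase d k ^ d = 1" if "k < d" for k
  proof -
    have "real d * (2 * pi * real k / real d) = 2 * pi * real k" using that by simp
    then show ?thesis by (simp only: phase_cis DeMoivre) (simp add: cis_multiple_2pi)
  qed
  show ?thesis
  proof (cases "s = t")
    case True
    then show ?thesis unfolding e by (simp add: phase_cnj)
  next
    case False
    have "inj_on (phase d) {..<d}"
      using bij_betw_roots_unity[of d] assms unfolding phase_cis bij_betw_def by auto
    then have "phase d s \<noteq> phase d t" using False assms by (auto dest: inj_onD)
    moreover have "phase d s = ?q * phase d t"
      using phase_cnj[of d t] by (metis mult.assoc mult.commute mult_1)
    ultimately have "?q \<noteq> 1" by (metis mult_1)
    moreover have "?q ^ d = 1"
      using pd[OF assms(1)] pd[OF assms(2)] by (simp add: power_mult_distrib flip: complex_cnj_power)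
    ultimately show ?thesis using False unfolding e by (simp add: sum_gp_strict)
  qed
qed

text \<open>The entries of V^j in spectral form; \<open>phase_unitary_pow_mat\<close> identifies
  them with those of the matrix power.\<close>

definition phase_power :: "nat \<Rightarrow> (nat \<Rightarrow> complex vec) \<Rightarrow> nat \<Rightarrow> nat \<Rightarrow> nat \<Rightarrow> complex" where
  "phase_power d e j a b = (\<Sum>s<d. phase d s ^ j * e s $ a * cnj (e s $ b))"

text \<open>\<open>rotated d m e j X\<close> is \<open>(V\<^sup>j \<otimes> 1) X (V\<^sup>j \<otimes> 1)\<^sup>*\<close>, and \<open>unrotate d m e j v\<close> is \<open>(V\<^sup>j \<otimes> 1)\<^sup>* v\<close>.\<close>

definition rotated :: "nat \<Rightarrow> nat \<Rightarrow> (nat \<Rightarrow> complex vec) \<Rightarrow> nat \<Rightarrow> (nat \<Rightarrow> nat \<Rightarrow> complex) \<Rightarrow> nat \<Rightarrow> nat \<Rightarrow> complex" where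
  "rotated d m e j X i i' = (\<Sum>x<d. \<Sum>y<d. phase_power d e j (i div m) x
      * X (x * m + i mod m) (y * m + i' mod m) * cnj (phase_power d e j (i' div m) y))"

definition unrotate :: "nat \<Rightarrow> nat \<Rightarrow> (nat \<Rightarrow> complex vec) \<Rightarrow> nat \<Rightarrow> (nat \<Rightarrow> complex) \<Rightarrow> nat \<Rightarrow> complex" where
  "unrotate d m e j v i = (\<Sum>a<d. cnj (phase_power d e j a (i div m)) * v (a * m + i mod m))"

lemma onb_of_orthonormal_basis: "orthonormal_basis d e \<Longrightarrow> onb d (\<lambda>s. ($) (e s))"
  unfolding orthonormal_basis_def onb_def ip_def cinner_def by (metis carrier_vecD)

section \<open>Powers of the phase unitary and conjugated states\<close>

context
  fixes d :: nat and e :: "nat \<Rightarrow> complex vec"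
  assumes e: "orthonormal_basis d e"
begin

lemma basis_ip: "s < d \<Longrightarrow> t < d \<Longrightarrow> (\<Sum>a<d. cnj (e s $ a) * e t $ a) = (if s = t then 1 else 0)"
  using onb_of_orthonormal_basis[OF e] by (simp add: onb_def ip_def)

text \<open>Orthonormality of \<open>e\<close> leaves only the term of \<open>s\<close> itself:
  \<open>e s\<close> is an eigenvector of the adjoint of V^j.\<close>

lemma cnj_phase_power_apply:
  assumes "s < d"
  shows "(\<Sum>a<d. cnj (phase_power d e j a x) * e s $ a) = cnj (phase d s ^ j) * e s $ x"
proof -
  have "(\<Sum>a<d. cnj (phase_power d e j a x) * e s $ a)
      = (\<Sum>a<d. \<Sum>t<d. cnj (phase d t ^ j) * e t $ x * (cnj (e t $ a) * e s $ a))"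
    by (simp add: phase_power_def sum_distrib_left sum_distrib_right mult_ac)
  also have "\<dots> = (\<Sum>t<d. cnj (phase d t ^ j) * e t $ x * (\<Sum>a<d. cnj (e t $ a) * e s $ a))"
    unfolding sum_distrib_left by (rule sum.swap)
  also have "\<dots> = (\<Sum>t<d. if t = s then cnj (phase d t ^ j) * e t $ x else 0)"
    using assms by (intro sum.cong refl) (simp add: basis_ip)
  also have "\<dots> = cnj (phase d s ^ j) * e s $ x" using assms by simp
  finally show ?thesis .
qed

lemma phase_power_unitary:
  assumes "x < d" "y < d"
  shows "(\<Sum>a<d. cnj (phase_power d e j a y) * phase_power d e j a x) = (if x = y then 1 else 0)"
proof -
  have "(\<Sum>a<d. cnj (phase_power d e j a y) * phase_power d e j a x)
      = (\<Sum>a<d. \<Sum>s<d. phase d s ^ j * cnj (e s $ x) * (cnj (phase_power d e j a y) * e s $ a))"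
    by (simp add: phase_power_def[of d e j _ x] sum_distrib_left mult_ac)
  also have "\<dots> = (\<Sum>s<d. phase d s ^ j * cnj (e s $ x) * (\<Sum>a<d. cnj (phase_power d e j a y) * e s $ a))"
    unfolding sum_distrib_left by (rule sum.swap)
  also have "\<dots> = (\<Sum>s<d. (phase d s * cnj (phase d s)) ^ j * (e s $ y * cnj (e s $ x)))"
    by (intro sum.cong refl) (simp add: cnj_phase_power_apply power_mult_distrib)
  also have "\<dots> = (\<Sum>s<d. e s $ y * cnj (e s $ x))" by (simp add: phase_cnj)
  also have "\<dots> = (if x = y then 1 else 0)"
    using onb_complete[OF onb_of_orthonormal_basis[OF e] assms(2,1)] by auto
  finally show ?thesis .
qed

lemma phase_unitary_pow_mat:
  "phase_unitary d e ^\<^sub>m j = mat d d (\<lambda>(a, b). phase_power d e j a b)"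
proof (induction j)
  case 0
  have "phase_unitary d e \<in> carrier_mat d d" by (simp add: phase_unitary_def msum_def)
  then show ?case
    using onb_complete[OF onb_of_orthonormal_basis[OF e]]
    by (intro eq_matI) (auto simp: phase_power_def)
next
  case (Suc j)
  have V: "phase_unitary d e = mat d d (\<lambda>(a, b). phase_power d e 1 a b)"
    using e by (intro eq_matI)
      (auto simp: phase_unitary_def msum_def phase_power_def outer_def orthonormal_basis_def phase_def mult.assoc intro!: sum.cong)
  show ?case
  proof (rule eq_matI)
    fix a b assume ab: "a < dim_row (mat d d (\<lambda>(a, b). phase_power d e (Suc j) a b))"
      "b < dim_col (mat d d (\<lambda>(a, b). phase_power d e (Suc j) a b))"
    have "(phase_unitary d e ^\<^sub>m Suc j) $$ (a, b) = (\<Sum>c<d. phase_power d e j a c * phase_power d e 1 c b)"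
      using ab by (simp add: Suc.IH, subst V) (simp add: scalar_prod_def lessThan_atLeast0)
    also have "\<dots> = (\<Sum>c<d. \<Sum>t<d. (phase d t * cnj (e t $ b)) * (phase_power d e j a c * e t $ c))"
      by (simp only: phase_power_def[of d e 1] sum_distrib_left power_one_right mult_ac)
    also have "\<dots> = (\<Sum>t<d. (phase d t * cnj (e t $ b)) * (\<Sum>c<d. phase_power d e j a c * e t $ c))"
      unfolding sum_distrib_left by (rule sum.swap)
    also have "\<dots> = (\<Sum>t<d. (phase d t * cnj (e t $ b)) * (phase d t ^ j * e t $ a))"
    proof (intro sum.cong refl arg_cong2[where f = times])
      fix t assume t: "t \<in> {..<d}"
      have "(\<Sum>c<d. phase_power d e j a c * e t $ c)
          = (\<Sum>c<d. \<Sum>s<d. phase d s ^ j * e s $ a * (cnj (e s $ c) * e t $ c))"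
        by (simp add: phase_power_def sum_distrib_left sum_distrib_right mult_ac)
      also have "\<dots> = (\<Sum>s<d. phase d s ^ j * e s $ a * (\<Sum>c<d. cnj (e s $ c) * e t $ c))"
        unfolding sum_distrib_left by (rule sum.swap)
      also have "\<dots> = (\<Sum>s<d. if s = t then phase d s ^ j * e s $ a else 0)"
        using t by (intro sum.cong refl) (simp add: basis_ip)
      finally show "(\<Sum>c<d. phase_power d e j a c * e t $ c) = phase d t ^ j * e t $ a"
        using t by simp
    qed
    finally show "(phase_unitary d e ^\<^sub>m Suc j) $$ (a, b) = mat d d (\<lambda>(a, b). phase_power d e (Suc j) a b) $$ (a, b)"
      using ab by (simp add: phase_power_def mult_ac)
  qed (use V in auto)
qed

lemma phase_damping_carrier [simp]: "phase_damping d e lam \<sigma> \<in> carrier_mat d d"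
  by (simp add: phase_damping_def msum_def)

lemma phase_damping_entry:
  assumes "\<sigma> \<in> carrier_mat d d" "a < d" "a' < d"
  shows "phase_damping d e lam \<sigma> $$ (a, a') = (\<Sum>j<d. complex_of_real (lam j) *
    (\<Sum>x<d. \<Sum>y<d. phase_power d e j a x * \<sigma> $$ (x, y) * cnj (phase_power d e j a' y)))"
proof -
  have entry: "(phase_unitary d e ^\<^sub>m j * \<sigma> * cadj (phase_unitary d e ^\<^sub>m j)) $$ (a, a')
      = (\<Sum>x<d. \<Sum>y<d. phase_power d e j a x * \<sigma> $$ (x, y) * cnj (phase_power d e j a' y))" for j
  proof -
    have "(phase_unitary d e ^\<^sub>m j * \<sigma> * cadj (phase_unitary d e ^\<^sub>m j)) $$ (a, a')
      = (\<Sum>y<d. \<Sum>x<d. phase_power d e j a x * \<sigma> $$ (x, y) * cnj (phase_power d e j a' y))"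
      using assms by (simp add: phase_unitary_pow_mat cadj_def scalar_prod_def lessThan_atLeast0 sum_distrib_right)
    also have "\<dots> = (\<Sum>x<d. \<Sum>y<d. phase_power d e j a x * \<sigma> $$ (x, y) * cnj (phase_power d e j a' y))"
      by (rule sum.swap)
    finally show ?thesis .
  qed
  have car: "phase_unitary d e ^\<^sub>m j * \<sigma> * cadj (phase_unitary d e ^\<^sub>m j) \<in> carrier_mat d d" for j
    using assms(1) by (intro carrier_matI) (auto simp: phase_unitary_pow_mat cadj_def)
  have smult: "(c \<cdot>\<^sub>m A) $$ (a, a') = c * A $$ (a, a')" if "A \<in> carrier_mat d d" for c and A :: "complex mat"
    using that assms(2,3) by simp
  have "phase_damping d e lam \<sigma> $$ (a, a') = (\<Sum>j<d. (complex_of_real (lam j) \<cdot>\<^sub>m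
      (phase_unitary d e ^\<^sub>m j * \<sigma> * cadj (phase_unitary d e ^\<^sub>m j))) $$ (a, a'))"
    using assms(2,3) unfolding phase_damping_def msum_def by simp
  then show ?thesis by (simp only: smult[OF car] entry)
qed

text \<open>Exhibits the channel output as the mixture of conjugates to which
  \<open>entropy_preparation_bound\<close> applies.\<close>

lemma left_apply_phase_damping_entry:
  assumes "i < d * m" "i' < d * m"
  shows "left_apply d m (phase_damping d e lam) X $$ (i, i')
    = (\<Sum>j<d. complex_of_real (lam j) * rotated d m e j (entries X) i i')"
proof -
  have "i div m < d" "i' div m < d" using assms by (auto simp: less_mult_imp_div_less)
  then show ?thesis using assms
    by (simp add: left_apply_def rotated_def phase_damping_entry)
qed

text \<open>The unitaries move onto the arguments as adjoints, the right one in \<open>inner\<close>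
  and the left one in \<open>outer\<close>. Positivity of the conjugate is then immediate.\<close>

lemma sesq_rotated:
  "sesq (d * m) (rotated d m e j X) v w = sesq (d * m) X (unrotate d m e j v) (unrotate d m e j w)"
proof -
  have inner: "(\<Sum>i'<d * m. rotated d m e j X i i' * w i')
      = (\<Sum>x<d. phase_power d e j (i div m) x * (\<Sum>i'<d * m. X (x * m + i mod m) i' * unrotate d m e j w i'))" for i
  proof -
    let ?f = "\<lambda>a b x y. phase_power d e j (i div m) x * (X (x * m + i mod m) (y * m + b)
        * (cnj (phase_power d e j a y) * w (a * m + b)))"
    have "(\<Sum>i'<d * m. rotated d m e j X i i' * w i') = (\<Sum>a<d. \<Sum>b<m. \<Sum>x<d. \<Sum>y<d. ?f a b x y)"
      by (simp add: sum_bipartite rotated_def sum_distrib_left sum_distrib_right mult_ac)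
    also have "\<dots> = (\<Sum>b<m. \<Sum>a<d. \<Sum>x<d. \<Sum>y<d. ?f a b x y)" by (rule sum.swap)
    also have "\<dots> = (\<Sum>b<m. \<Sum>x<d. \<Sum>a<d. \<Sum>y<d. ?f a b x y)" by (intro sum.cong refl sum.swap)
    also have "\<dots> = (\<Sum>x<d. \<Sum>b<m. \<Sum>a<d. \<Sum>y<d. ?f a b x y)" by (rule sum.swap)
    also have "\<dots> = (\<Sum>x<d. \<Sum>b<m. \<Sum>y<d. \<Sum>a<d. ?f a b x y)" by (intro sum.cong refl sum.swap)
    also have "\<dots> = (\<Sum>x<d. \<Sum>y<d. \<Sum>b<m. \<Sum>a<d. ?f a b x y)" by (intro sum.cong refl sum.swap)
    also have "\<dots> = (\<Sum>x<d. phase_power d e j (i div m) x * (\<Sum>i'<d * m. X (x * m + i mod m) i' * unrotate d m e j w i'))"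
      by (simp add: sum_bipartite unrotate_def sum_distrib_left)
    finally show ?thesis .
  qed
  have outer: "ip (d * m) v (\<lambda>i. \<Sum>x<d. phase_power d e j (i div m) x * z (x * m + i mod m)) = ip (d * m) (unrotate d m e j v) z" for z
  proof -
    let ?f = "\<lambda>a b x. cnj (v (a * m + b)) * (phase_power d e j a x * z (x * m + b))"
    have "ip (d * m) v (\<lambda>i. \<Sum>x<d. phase_power d e j (i div m) x * z (x * m + i mod m))
        = (\<Sum>a<d. \<Sum>b<m. \<Sum>x<d. ?f a b x)"
      by (simp add: ip_def sum_bipartite sum_distrib_left)
    also have "\<dots> = (\<Sum>b<m. \<Sum>a<d. \<Sum>x<d. ?f a b x)" by (rule sum.swap)
    also have "\<dots> = (\<Sum>b<m. \<Sum>x<d. \<Sum>a<d. ?f a b x)" by (intro sum.cong refl sum.swap)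
    also have "\<dots> = (\<Sum>x<d. \<Sum>b<m. \<Sum>a<d. ?f a b x)" by (rule sum.swap)
    also have "\<dots> = ip (d * m) (unrotate d m e j v) z"
      by (simp add: ip_def sum_bipartite unrotate_def sum_distrib_left sum_distrib_right mult_ac)
    finally show ?thesis .
  qed
  show ?thesis
    unfolding sesq_as_ip inner
    by (rule outer[of "\<lambda>k. \<Sum>i'<d * m. X k i' * unrotate d m e j w i'"])
qed

lemma positive_rotated:
  assumes "positive (d * m) X"
  shows "positive (d * m) (rotated d m e j X)"
  unfolding positive_def
proof (intro conjI allI)
  show "0 \<le> Re (sesq (d * m) (rotated d m e j X) v v)" for v
    using assms by (simp add: sesq_rotated positive_def)
  show "hermitian (d * m) (rotated d m e j X)"
    using assms by (simp add: hermitian_iff_sesq sesq_rotated positive_def)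
qed

text \<open>Summing over \<open>a\<close> first, unitarity of V^j identifies \<open>x\<close> with
  \<open>y\<close>.\<close>

lemma trace_rotated: "(\<Sum>i<d * m. rotated d m e j X i i) = (\<Sum>i<d * m. X i i)"
proof -
  let ?f = "\<lambda>a b x y. X (x * m + b) (y * m + b) * (cnj (phase_power d e j a y) * phase_power d e j a x)"
  have "(\<Sum>i<d * m. rotated d m e j X i i) = (\<Sum>a<d. \<Sum>b<m. \<Sum>x<d. \<Sum>y<d. ?f a b x y)"
    by (simp add: sum_bipartite rotated_def mult_ac)
  also have "\<dots> = (\<Sum>b<m. \<Sum>a<d. \<Sum>x<d. \<Sum>y<d. ?f a b x y)" by (rule sum.swap)
  also have "\<dots> = (\<Sum>b<m. \<Sum>x<d. \<Sum>a<d. \<Sum>y<d. ?f a b x y)" by (intro sum.cong refl sum.swap)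
  also have "\<dots> = (\<Sum>b<m. \<Sum>x<d. \<Sum>y<d. \<Sum>a<d. ?f a b x y)" by (intro sum.cong refl sum.swap)
  also have "\<dots> = (\<Sum>b<m. \<Sum>x<d. \<Sum>y<d. if x = y then X (x * m + b) (y * m + b) else 0)"
    unfolding sum_distrib_left[symmetric] by (intro sum.cong refl) (simp add: phase_power_unitary)
  also have "\<dots> = (\<Sum>b<m. \<Sum>x<d. X (x * m + b) (x * m + b))" by simp
  also have "\<dots> = (\<Sum>i<d * m. X i i)" unfolding sum_bipartite by (rule sum.swap)
  finally show ?thesis .
qed

lemma left_apply_phase_damping_density:
  assumes "prob_dist d lam" "X \<in> density (d * m)"
  shows "left_apply d m (phase_damping d e lam) X \<in> density (d * m)"
proof -
  let ?Y = "left_apply d m (phase_damping d e lam) X"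
  let ?R = "\<lambda>i i'. \<Sum>j<d. complex_of_real (lam j) * rotated d m e j (entries X) i i'"
  have eq: "?Y $$ (i, i') = ?R i i'" if "i < d * m" "i' < d * m" for i i'
    using left_apply_phase_damping_entry[OF that] .
  have "positive (d * m) ?R"
    using assms by (intro positive_combination positive_rotated) (auto simp: density_iff prob_dist_def)
  then have "positive (d * m) (entries ?Y)"
    unfolding positive_def hermitian_def using eq sesq_cong[of "d * m" "entries ?Y" ?R] by simp
  moreover have "(\<Sum>i<d * m. ?Y $$ (i, i)) = 1"
  proof -
    have "(\<Sum>i<d * m. ?Y $$ (i, i)) = (\<Sum>i<d * m. ?R i i)" using eq by simp
    also have "\<dots> = (\<Sum>j<d. complex_of_real (lam j) * (\<Sum>i<d * m. rotated d m e j (entries X) i i))"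
      unfolding sum_distrib_left by (rule sum.swap)
    also have "\<dots> = complex_of_real (\<Sum>j<d. lam j)"
      using assms(2) by (simp add: trace_rotated density_iff)
    also have "\<dots> = 1" using assms(1) by (simp add: prob_dist_def)
    finally show ?thesis .
  qed
  ultimately show ?thesis by (simp add: density_iff left_apply_def)
qed

text \<open>The case of a one-dimensional second factor, where \<open>left_apply\<close> reduces to
  the channel itself.\<close>

lemma phase_damping_density:
  assumes "prob_dist d lam" "\<sigma> \<in> density d"
  shows "phase_damping d e lam \<sigma> \<in> density d"
proof -
  have "mat d d (\<lambda>(x, y). \<sigma> $$ (x, y)) = \<sigma>" using assms(2) by (intro eq_matI) (auto simp: density_iff)
  then have "left_apply d 1 (phase_damping d e lam) \<sigma> = phase_damping d e lam \<sigma>"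
    unfolding left_apply_def
    by (intro eq_matI) (use carrier_matD[OF phase_damping_carrier[of lam \<sigma>]] in auto)
  then show ?thesis using left_apply_phase_damping_density[of lam \<sigma> 1] assms by simp
qed

end

section \<open>Blocks and unbiased states\<close>

lemma sesq_rank_one: "sesq n (\<lambda>x y. v x * cnj (v y)) p q = ip n p v * ip n v q"
  unfolding sesq_def ip_def sum_product by (simp only: mult_ac)

lemma ip_bipartite:
  "ip (d * m) (\<lambda>i. v (i div m) * w (i mod m)) (\<lambda>i. v' (i div m) * w' (i mod m)) = ip d v v' * ip m w w'"
  by (simp add: ip_def sum_bipartite sum_product mult_ac)

text \<open>The diagonal block \<open>(<v| \<otimes> 1) X (|v> \<otimes> 1)\<close>.\<close>

definition block :: "nat \<Rightarrow> nat \<Rightarrow> (nat \<Rightarrow> complex) \<Rightarrow> (nat \<Rightarrow> nat \<Rightarrow> complex) \<Rightarrow> nat \<Rightarrow> nat \<Rightarrow> complex" where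
  "block d m v X b b' = (\<Sum>a<d. \<Sum>a'<d. cnj (v a) * X (a * m + b) (a' * m + b') * v a')"

lemma sesq_block:
  "sesq m (block d m v X) w w' = sesq (d * m) X (\<lambda>i. v (i div m) * w (i mod m)) (\<lambda>i. v (i div m) * w' (i mod m))"
proof -
  let ?f = "\<lambda>b b' a a'. cnj (v a * w b) * X (a * m + b) (a' * m + b') * (v a' * w' b')"
  have "sesq m (block d m v X) w w' = (\<Sum>b<m. \<Sum>b'<m. \<Sum>a<d. \<Sum>a'<d. ?f b b' a a')"
    by (simp add: sesq_def block_def sum_distrib_left sum_distrib_right mult_ac)
  also have "\<dots> = (\<Sum>b<m. \<Sum>a<d. \<Sum>b'<m. \<Sum>a'<d. ?f b b' a a')" by (intro sum.cong refl sum.swap)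
  also have "\<dots> = (\<Sum>a<d. \<Sum>b<m. \<Sum>b'<m. \<Sum>a'<d. ?f b b' a a')" by (rule sum.swap)
  also have "\<dots> = (\<Sum>a<d. \<Sum>b<m. \<Sum>a'<d. \<Sum>b'<m. ?f b b' a a')" by (intro sum.cong refl sum.swap)
  also have "\<dots> = sesq (d * m) X (\<lambda>i. v (i div m) * w (i mod m)) (\<lambda>i. v (i div m) * w' (i mod m))"
    by (simp add: sesq_def sum_bipartite)
  finally show ?thesis .
qed

lemma positive_block:
  assumes "positive (d * m) X"
  shows "positive m (block d m v X)"
  using assms by (simp add: positive_def hermitian_iff_sesq sesq_block)

lemma positive_scale:
  assumes "positive n M" "0 \<le> c"
  shows "positive n (\<lambda>x y. complex_of_real c * M x y)"
  using positive_combination[of "Suc 0" n "\<lambda>_. M" "\<lambda>_. c"] assms by (simp add: lessThan_Suc)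

lemma positive_cong:
  assumes "\<And>i j. i < n \<Longrightarrow> j < n \<Longrightarrow> M i j = M' i j"
  shows "positive n M \<longleftrightarrow> positive n M'"
  using sesq_cong[of n M M'] assms by (simp add: positive_def hermitian_iff_sesq)

text \<open>The weight of a block depends on the first marginal only, which is where its
  unbiasedness enters.\<close>

lemma trace_block:
  "(\<Sum>b<m. block d m v (entries X) b b) = sesq d (entries (ptrace2 d m X)) v v"
proof -
  let ?f = "\<lambda>b a a'. cnj (v a) * X $$ (a * m + b, a' * m + b) * v a'"
  have "(\<Sum>b<m. block d m v (entries X) b b) = (\<Sum>a<d. \<Sum>b<m. \<Sum>a'<d. ?f b a a')"
    unfolding block_def by (rule sum.swap)
  also have "\<dots> = (\<Sum>a<d. \<Sum>a'<d. \<Sum>b<m. ?f b a a')" by (intro sum.cong refl sum.swap)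
  also have "\<dots> = sesq d (entries (ptrace2 d m X)) v v"
    by (simp add: sesq_def ptrace2_def sum_distrib_left sum_distrib_right)
  finally show ?thesis .
qed

text \<open>Completeness of \<open>u\<close> removes the terms with distinct \<open>a\<close> and
  \<open>a'\<close>. The normalized blocks thereby decompose the second marginal.\<close>

lemma sum_blocks:
  assumes "onb d u" "b < m" "b' < m"
  shows "(\<Sum>s<d. block d m (u s) (entries X) b b') = ptrace1 d m X $$ (b, b')"
proof -
  let ?f = "\<lambda>s a a'. X $$ (a * m + b, a' * m + b') * (u s a' * cnj (u s a))"
  have "(\<Sum>s<d. block d m (u s) (entries X) b b') = (\<Sum>s<d. \<Sum>a<d. \<Sum>a'<d. ?f s a a')"
    by (simp add: block_def mult_ac)
  also have "\<dots> = (\<Sum>a<d. \<Sum>s<d. \<Sum>a'<d. ?f s a a')" by (rule sum.swap)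
  also have "\<dots> = (\<Sum>a<d. \<Sum>a'<d. \<Sum>s<d. ?f s a a')" by (intro sum.cong refl sum.swap)
  also have "\<dots> = (\<Sum>a<d. \<Sum>a'<d. if a' = a then X $$ (a * m + b, a' * m + b') else 0)"
    unfolding sum_distrib_left[symmetric] by (intro sum.cong refl) (simp add: onb_complete[OF assms(1)])
  also have "\<dots> = ptrace1 d m X $$ (b, b')" using assms by (simp add: ptrace1_def)
  finally show ?thesis .
qed

lemma right_apply_density:
  assumes "quantum_channel m \<Omega>" "\<rho> \<in> density (d * m)"
  shows "right_apply d m \<Omega> \<rho> \<in> density (d * m)"
proof -
  \<comment> \<open>Only the diagonal submatrices of \<open>\<rho>\<close> enter the trace, and
    \<open>\<Omega>\<close> preserves the trace of each.\<close>
  define R where "R a = mat m m (\<lambda>(x, y). \<rho> $$ (a * m + x, a * m + y))" for a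
  have "ctrace (right_apply d m \<Omega> \<rho>) = (\<Sum>a<d. \<Sum>b<m. \<Omega> (R a) $$ (b, b))"
    by (simp add: ctrace_def right_apply_def sum_bipartite bipartite_less R_def)
  also have "\<dots> = (\<Sum>a<d. ctrace (\<Omega> (R a)))"
  proof (intro sum.cong refl)
    fix a
    have "\<Omega> (R a) \<in> carrier_mat m m"
      using assms(1) by (simp add: quantum_channel_def linear_map_on_def R_def)
    then show "(\<Sum>b<m. \<Omega> (R a) $$ (b, b)) = ctrace (\<Omega> (R a))" by (simp add: ctrace_def)
  qed
  also have "\<dots> = (\<Sum>a<d. ctrace (R a))"
    using assms(1) by (simp add: quantum_channel_def trace_preserving_def R_def)
  also have "\<dots> = (\<Sum>i<d * m. \<rho> $$ (i, i))"
    by (simp add: ctrace_def R_def sum_bipartite)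
  finally show ?thesis
    using assms by (auto simp: density_def quantum_channel_def completely_positive_def)
      (auto simp: psd_def ctrace_def)
qed

text \<open>A block is a linear combination of the \<open>m\<close> by \<open>m\<close> submatrices
  of \<open>\<rho>\<close>, on each of which \<open>right_apply\<close> acts separately, so
  \<open>\<Omega>\<close> passes through. The factor \<open>c\<close> accommodates normalization by
  \<open>d\<close>.\<close>

lemma channel_block:
  assumes "linear_map_on m \<Omega>" "b < m" "b' < m"
  shows "\<Omega> (mat m m (\<lambda>(b, b'). c * block d m v (entries \<rho>) b b')) $$ (b, b')
    = c * block d m v (entries (right_apply d m \<Omega> \<rho>)) b b'"
proof -
  define R where "R = (\<lambda>(a, a'). mat m m (\<lambda>(x, y). \<rho> $$ (a * m + x, a' * m + y)))"
  let ?c = "\<lambda>(a, a'). c * (cnj (v a) * v a')"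
  have prod: "(\<Sum>k\<in>{..<d} \<times> {..<d}. h k) = (\<Sum>a<d. \<Sum>a'<d. h (a, a'))" for h :: "nat \<times> nat \<Rightarrow> complex"
    by (simp add: sum.cartesian_product split_def)
  have "mat m m (\<lambda>(b, b'). c * block d m v (entries \<rho>) b b')
      = mat m m (\<lambda>(b, b'). \<Sum>k\<in>{..<d} \<times> {..<d}. ?c k * R k $$ (b, b'))"
    unfolding prod by (intro eq_matI) (auto simp: block_def R_def sum_distrib_left mult_ac)
  then have "\<Omega> (mat m m (\<lambda>(b, b'). c * block d m v (entries \<rho>) b b')) $$ (b, b')
      = (\<Sum>k\<in>{..<d} \<times> {..<d}. ?c k * \<Omega> (R k) $$ (b, b'))"
    using linear_map_on_sum[OF assms(1), of "{..<d} \<times> {..<d}" R ?c] assms(2,3) by (auto simp: R_def)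
  also have "\<dots> = (\<Sum>a<d. \<Sum>a'<d. ?c (a, a') * \<Omega> (R (a, a')) $$ (b, b'))"
    by (rule prod)
  also have "\<dots> = c * block d m v (entries (right_apply d m \<Omega> \<rho>)) b b'"
    using assms(2,3)
    by (simp add: block_def right_apply_def R_def bipartite_less sum_distrib_left mult_ac)
  finally show ?thesis .
qed

section \<open>Unbiased pure states under phase damping\<close>

context
  fixes d :: nat and e :: "nat \<Rightarrow> complex vec"
  assumes e: "orthonormal_basis d e"
begin

lemma unbiased_ip:
  assumes "\<forall>s<d. cmod (cinner f (e s)) = 1 / sqrt (real d)" "f \<in> carrier_vec d" "s < d"
  shows "ip d (($) (e s)) (($) f) * cnj (ip d (($) (e s)) (($) f)) = 1 / of_nat d"
proof -
  have "ip d (($) (e s)) (($) f) = cnj (cinner f (e s))"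
    using assms(2) by (simp add: cinner_def ip_def mult.commute)
  then have "cmod (ip d (($) (e s)) (($) f)) = 1 / sqrt (real d)"
    using assms by simp
  then have "complex_of_real ((cmod (ip d (($) (e s)) (($) f)))\<^sup>2) = complex_of_real (1 / real d)"
    by (simp add: power_divide)
  then show ?thesis unfolding complex_norm_square by simp
qed

text \<open>Every pure component has the same squared overlap 1/d with \<open>e s\<close>, so the
  convex weights simply add up to 1.\<close>

lemma unbiased_diagonal:
  assumes "\<sigma> \<in> unbiased_states d e" "s < d"
  shows "sesq d (entries \<sigma>) (($) (e s)) (($) (e s)) = 1 / of_nat d"
proof -
  obtain N p f where pf: "\<forall>j<N. p j \<ge> 0 \<and> f j \<in> carrier_vec d \<and> (\<forall>s<d. cmod (cinner (f j) (e s)) = 1 / sqrt (real d))"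
    "(\<Sum>j<N. p j) = 1" "\<sigma> = msum d N (\<lambda>j. complex_of_real (p j) \<cdot>\<^sub>m outer (f j) (f j))"
    using assms(1) by (auto simp: unbiased_states_def)
  have "sesq d (entries \<sigma>) (($) (e s)) (($) (e s))
      = sesq d (\<lambda>x y. \<Sum>j<N. complex_of_real (p j) * (f j $ x * cnj (f j $ y))) (($) (e s)) (($) (e s))"
    by (rule sesq_cong) (use pf in \<open>auto simp: msum_def outer_def intro!: sum.cong\<close>)
  also have "\<dots> = (\<Sum>j<N. complex_of_real (p j) * (1 / of_nat d))"
    unfolding sesq_sum_matrix sesq_rank_one
    by (intro sum.cong refl arg_cong2[where f = times])
       (use pf assms(2) unbiased_ip in \<open>auto simp: cnj_ip\<close>)
  also have "\<dots> = 1 / of_nat d" using pf(2) by (simp flip: sum_divide_distrib of_real_sum)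
  finally show ?thesis .
qed

lemma unbiased_pure_density:
  assumes "\<forall>s<d. cmod (cinner f (e s)) = 1 / sqrt (real d)" "f \<in> carrier_vec d" "0 < d"
  shows "outer f f \<in> density d"
proof -
  have "positive d (\<lambda>x y. f $ x * cnj (f $ y))"
    unfolding positive_def hermitian_iff_sesq sesq_rank_one
  proof (intro conjI allI)
    fix v w
    show "cnj (ip d v (($) f) * ip d (($) f) w) = ip d w (($) f) * ip d (($) f) v"
      by (simp add: cnj_ip)
    have "ip d v (($) f) * ip d (($) f) v = complex_of_real ((cmod (ip d v (($) f)))\<^sup>2)"
      unfolding complex_norm_square cnj_ip ..
    then show "0 \<le> Re (ip d v (($) f) * ip d (($) f) v)" by simp
  qed
  then have "positive d (entries (outer f f))"
    using positive_cong[of d "entries (outer f f)" "\<lambda>x y. f $ x * cnj (f $ y)"] assms(2)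
    by (simp add: outer_def)
  moreover have "(\<Sum>i<d. outer f f $$ (i, i)) = 1"
  proof -
    have "(\<Sum>i<d. outer f f $$ (i, i)) = ip d (($) f) (($) f)"
      using assms(2) by (simp add: outer_def ip_def mult.commute)
    also have "\<dots> = (\<Sum>s<d. ip d (($) (e s)) (($) f) * cnj (ip d (($) (e s)) (($) f)))"
      using parseval[OF onb_of_orthonormal_basis[OF e], of "($) f" "($) f"]
      by (simp only: cnj_ip mult.commute)
    also have "\<dots> = 1" using unbiased_ip[OF assms(1,2)] assms(3) by simp
    finally show ?thesis .
  qed
  ultimately show ?thesis using assms(2) by (simp add: density_iff outer_def)
qed

text \<open>The inner product of V^k f and V^l f is a character sum with weights |<e_s, f>|^2. All
  weights are 1/d, so it is 1 or 0 and the V^j f form an eigenbasis of the output.\<close>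

lemma vN_entropy_phase_damping_unbiased:
  assumes f: "\<forall>s<d. cmod (cinner f (e s)) = 1 / sqrt (real d)" "f \<in> carrier_vec d" and d: "0 < d"
  shows "vN_entropy (phase_damping d e lam (outer f f)) = (\<Sum>j<d. eta (lam j))"
proof -
  let ?u = "\<lambda>s. ($) (e s)"
  define c where "c s = ip d (?u s) (($) f)" for s
  \<comment> \<open>\<open>g j\<close> is V^j f, expressed by the coordinates \<open>c s\<close> of
    f in the basis \<open>e\<close>.\<close>
  define g where "g j = (\<lambda>a. \<Sum>s<d. (phase d s ^ j * c s) * e s $ a)" for j
  have u: "onb d ?u" using onb_of_orthonormal_basis[OF e] .
  have gg: "ip d (g k) (g l) = (if k = l then 1 else 0)" if "k < d" "l < d" for k l
  proof -
    have "ip d (g k) (g l) = (\<Sum>s<d. \<Sum>t<d. if s = t then cnj (phase d k ^ s * c s) * (phase d l ^ t * c t) else 0)"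
      unfolding g_def ip_sum_left ip_sum_right sum_distrib_left
      unfolding phase_power_comm[of d _ k] phase_power_comm[of d _ l]
      using u by (intro sum.cong refl) (simp add: onb_def)
    also have "\<dots> = (\<Sum>s<d. (c s * cnj (c s)) * (phase d l ^ s * cnj (phase d k ^ s)))"
      by (simp add: mult_ac)
    also have "\<dots> = (\<Sum>s<d. 1 / of_nat d * (phase d l ^ s * cnj (phase d k ^ s)))"
      by (intro sum.cong refl) (use unbiased_ip[OF f] in \<open>simp add: c_def\<close>)
    also have "\<dots> = (if k = l then 1 else 0)"
      unfolding sum_distrib_left[symmetric] sum_phase_powers[OF that(2,1)] using d by simp
    finally show ?thesis .
  qed
  have W: "(\<Sum>x<d. phase_power d e j a x * f $ x) = g j a" for j a
  proof -
    have "(\<Sum>x<d. phase_power d e j a x * f $ x) = (\<Sum>x<d. \<Sum>s<d. (phase d s ^ j * e s $ a) * (cnj (e s $ x) * f $ x))"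
      by (simp add: phase_power_def sum_distrib_left sum_distrib_right mult_ac)
    also have "\<dots> = (\<Sum>s<d. (phase d s ^ j * e s $ a) * (\<Sum>x<d. cnj (e s $ x) * f $ x))"
      unfolding sum_distrib_left by (rule sum.swap)
    also have "\<dots> = g j a" by (simp add: g_def c_def ip_def mult_ac)
    finally show ?thesis .
  qed
  let ?\<Phi> = "phase_damping d e lam (outer f f)"
  have ent: "?\<Phi> $$ (a, a') = (\<Sum>j<d. complex_of_real (lam j) * (g j a * cnj (g j a')))" if "a < d" "a' < d" for a a'
  proof -
    have "outer f f \<in> carrier_mat d d" using f(2) by (simp add: outer_def)
    then have "?\<Phi> $$ (a, a') = (\<Sum>j<d. complex_of_real (lam j) * (\<Sum>x<d. \<Sum>y<d.
        (phase_power d e j a x * f $ x) * cnj (phase_power d e j a' y * f $ y)))"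
      unfolding phase_damping_entry[OF e \<open>outer f f \<in> carrier_mat d d\<close> that]
      using f(2) by (simp add: outer_def mult_ac)
    then show ?thesis by (simp only: W cnj_sum[symmetric] sum_product[symmetric])
  qed
  have "sesq d (entries ?\<Phi>) (g k) (g l) = (if k = l then complex_of_real (lam k) else 0)" if kl: "k < d" "l < d" for k l
  proof -
    have "sesq d (entries ?\<Phi>) (g k) (g l)
        = sesq d (\<lambda>x y. \<Sum>j<d. complex_of_real (lam j) * (g j x * cnj (g j y))) (g k) (g l)"
      by (rule sesq_cong) (simp_all add: ent)
    also have "\<dots> = (\<Sum>j<d. if k = j then (if j = l then complex_of_real (lam j) else 0) else 0)"
      unfolding sesq_sum_matrix sesq_rank_one using kl by (intro sum.cong refl) (simp add: gg)
    finally show ?thesis using kl by simp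
  qed
  then have "diagonalizes d (entries ?\<Phi>) g lam" using gg by (simp add: diagonalizes_def onb_def)
  then show ?thesis using vN_entropy_eq_sum_eta[of ?\<Phi> d] phase_damping_carrier[OF e] by blast
qed

text \<open>The decomposition witnessing membership in \<open>unbiased_states\<close> is admissible
  in the infimum, and all its terms have the same output entropy.\<close>

lemma H_phase_damping_le:
  assumes lam: "prob_dist d lam" and \<sigma>: "\<sigma> \<in> unbiased_states d e"
  shows "H_chan d (phase_damping d e lam) \<sigma> \<le> (\<Sum>j<d. eta (lam j))"
proof -
  obtain N p f where pf: "\<forall>j<N. p j \<ge> 0 \<and> f j \<in> carrier_vec d \<and> (\<forall>s<d. cmod (cinner (f j) (e s)) = 1 / sqrt (real d))"
    "(\<Sum>j<N. p j) = 1" "\<sigma> = msum d N (\<lambda>j. complex_of_real (p j) \<cdot>\<^sub>m outer (f j) (f j))"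
    using \<sigma> by (auto simp: unbiased_states_def)
  have d: "0 < d" using lam by (auto simp: prob_dist_def intro: gr0I)
  have "H_chan d (phase_damping d e lam) \<sigma> \<le> (\<Sum>j<N. p j * vN_entropy (phase_damping d e lam (outer (f j) (f j))))"
    by (rule H_chan_le[OF phase_damping_density[OF e lam] _ pf(2) _ pf(3)])
       (use pf(1) d unbiased_pure_density in auto)
  also have "\<dots> = (\<Sum>j<N. p j * (\<Sum>j<d. eta (lam j)))"
    using pf(1) d vN_entropy_phase_damping_unbiased by (intro sum.cong refl) auto
  also have "\<dots> = (\<Sum>j<d. eta (lam j))" using pf(2) by (simp flip: sum_distrib_right)
  finally show ?thesis .
qed

end

section \<open>The entropy bound\<close>

context
  fixes d m :: nat and e :: "nat \<Rightarrow> complex vec"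
  assumes e: "orthonormal_basis d e" and m: "0 < m"
begin

lemma unrotate_product:
  assumes "s < d"
  shows "unrotate d m e j (\<lambda>i. e s $ (i div m) * w (i mod m))
    = (\<lambda>i. cnj (phase d s ^ j) * (e s $ (i div m) * w (i mod m)))"
proof
  fix i
  have "unrotate d m e j (\<lambda>i. e s $ (i div m) * w (i mod m)) i
      = (\<Sum>a<d. cnj (phase_power d e j a (i div m)) * e s $ a) * w (i mod m)"
    using m by (simp add: unrotate_def sum_distrib_right mult.assoc)
  then show "unrotate d m e j (\<lambda>i. e s $ (i div m) * w (i mod m)) i
      = cnj (phase d s ^ j) * (e s $ (i div m) * w (i mod m))"
    by (simp add: cnj_phase_power_apply[OF e assms] mult.assoc)
qed

text \<open>The basis of the second factor may vary with the block: between distinct blocks the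
  factor <e_s, e_t> already vanishes.\<close>

lemma onb_product:
  assumes "\<And>s. s < d \<Longrightarrow> onb m (w s)"
  shows "onb (d * m) (\<lambda>p i. e (p div m) $ (i div m) * w (p div m) (p mod m) (i mod m))"
  unfolding onb_def
proof (intro allI impI)
  fix p q assume pq: "p < d * m" "q < d * m"
  then have lt: "p div m < d" "q div m < d" "p mod m < m" "q mod m < m"
    using m by (auto simp: less_mult_imp_div_less)
  have eq: "p = q \<longleftrightarrow> p div m = q div m \<and> p mod m = q mod m"
    by (metis div_mult_mod_eq)
  show "ip (d * m) (\<lambda>i. e (p div m) $ (i div m) * w (p div m) (p mod m) (i mod m))
     (\<lambda>i. e (q div m) $ (i div m) * w (q div m) (q mod m) (i mod m)) = (if p = q then 1 else 0)"
    unfolding ip_bipartite[of d m "($) (e (p div m))" _ "($) (e (q div m))"] eq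
    using lt assms onb_of_orthonormal_basis[OF e] by (auto simp: onb_def)
qed

text \<open>Product vectors over \<open>e\<close> are eigenvectors of the rotation. The resulting
  phase is 1 for \<open>s = t\<close>, so diagonal blocks are unchanged, and its average over
  \<open>j\<close> is 0 otherwise.\<close>

lemma sesq_rotated_product:
  assumes "s < d" "t < d"
  shows "sesq (d * m) (rotated d m e j X) (\<lambda>i. e s $ (i div m) * w (i mod m)) (\<lambda>i. e t $ (i div m) * w' (i mod m))
    = (phase d s ^ j * cnj (phase d t ^ j))
      * sesq (d * m) X (\<lambda>i. e s $ (i div m) * w (i mod m)) (\<lambda>i. e t $ (i div m) * w' (i mod m))"
  unfolding sesq_rotated[OF e] unrotate_product[OF assms(1)] unrotate_product[OF assms(2)]
    sesq_scale_left sesq_scale_right by simp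

text \<open>Applies \<open>entropy_preparation_bound\<close> to the conjugates of \<open>X\<close>
  with \<open>mu j = 1 / d\<close>. The ln d from the uniform distribution cancels the ln d from
  rescaling the eigenvalues of the \<open>B s\<close>.\<close>

lemma entropy_phase_damping_ge:
  assumes lam: "prob_dist d lam" and X: "X \<in> density (d * m)"
    and B: "\<And>s. s < d \<Longrightarrow> B s \<in> density m"
    and XB: "\<And>s b b'. s < d \<Longrightarrow> b < m \<Longrightarrow> b' < m \<Longrightarrow> B s $$ (b, b') = of_nat d * block d m (($) (e s)) (entries X) b b'"
  shows "(\<Sum>j<d. eta (lam j)) + (\<Sum>s<d. 1 / real d * vN_entropy (B s))
    \<le> vN_entropy (left_apply d m (phase_damping d e lam) X)"
proof -
  let ?Y = "left_apply d m (phase_damping d e lam) X"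
  let ?M = "\<lambda>x y. \<Sum>j<d. complex_of_real (lam j) * rotated d m e j (entries X) x y"
  let ?E = "\<lambda>x y. \<Sum>j<d. complex_of_real (1 / real d) * rotated d m e j (entries X) x y"
  have d: "0 < d" using lam by (auto simp: prob_dist_def intro: gr0I)
  have "\<exists>u a. diagonalizes m (entries (B s)) u a" if "s < d" for s
    using B[OF that] by (intro spectral_theorem) (simp add: density_iff positive_def)
  then obtain w \<beta> where diag: "\<And>s. s < d \<Longrightarrow> diagonalizes m (entries (B s)) (w s) (\<beta> s)" by metis
  have \<beta>0: "0 \<le> \<beta> s k" if "s < d" "k < m" for s k
    using eigenvalue_nonneg[OF _ diag[OF that(1)] that(2)] B[OF that(1)] by (simp add: density_iff)
  have \<beta>1: "(\<Sum>k<m. \<beta> s k) = 1" if "s < d" for s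
  proof -
    have "complex_of_real (\<Sum>k<m. \<beta> s k) = 1"
      using sum_eigenvalues[OF diag[OF that]] B[OF that] by (simp add: density_iff)
    then show ?thesis using of_real_eq_1_iff by blast
  qed
  \<comment> \<open>The eigenbasis of the uniform mixture: index p = s m + k stands for e_s tensor
    the k-th eigenvector of \<open>B s\<close>, with eigenvalue
    \<open>\<beta> s k / real d\<close>.\<close>
  define v where "v p i = e (p div m) $ (i div m) * w (p div m) (p mod m) (i mod m)" for p i
  define b where "b p = \<beta> (p div m) (p mod m) / real d" for p
  have lt: "p div m < d" "p mod m < m" if "p < d * m" for p
    using that m by (auto simp: less_mult_imp_div_less)
  have onb_v: "onb (d * m) v"
    using onb_product[of w] diag unfolding v_def diagonalizes_def by blast
  \<comment> \<open>Within one block \<open>X\<close> itself is diagonal in \<open>v\<close>;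
    elements between different blocks are left open and are removed by averaging in
    \<open>E\<close>.\<close>
  have Xv: "sesq (d * m) (entries X) (v p) (v q) = (if p = q then complex_of_real (b p) else 0)"
    if pq: "p < d * m" "q < d * m" "p div m = q div m" for p q
  proof -
    let ?s = "p div m"
    have s: "?s < d" using lt pq by simp
    have "of_nat d * sesq (d * m) (entries X) (v p) (v q)
        = of_nat d * sesq m (block d m (($) (e ?s)) (entries X)) (w ?s (p mod m)) (w ?s (q mod m))"
      unfolding v_def sesq_block using pq(3) by simp
    also have "\<dots> = sesq m (\<lambda>x y. of_nat d * block d m (($) (e ?s)) (entries X) x y) (w ?s (p mod m)) (w ?s (q mod m))"
      by (simp add: sesq_def sum_distrib_left mult_ac)
    also have "\<dots> = sesq m (entries (B ?s)) (w ?s (p mod m)) (w ?s (q mod m))"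
      by (rule sesq_cong) (use XB[OF s] in auto)
    also have "\<dots> = (if p mod m = q mod m then complex_of_real (\<beta> ?s (p mod m)) else 0)"
      using diag[OF s] lt pq by (auto simp: diagonalizes_def)
    finally have "sesq (d * m) (entries X) (v p) (v q)
        = (if p mod m = q mod m then complex_of_real (\<beta> ?s (p mod m)) else 0) / of_nat d"
      using d by (simp add: field_simps)
    moreover have "p = q \<longleftrightarrow> p mod m = q mod m" using pq(3) by (metis div_mult_mod_eq)
    ultimately show ?thesis by (simp add: b_def)
  qed
  have rot: "sesq (d * m) (rotated d m e j (entries X)) (v p) (v q)
      = (phase d (p div m) ^ j * cnj (phase d (q div m) ^ j)) * sesq (d * m) (entries X) (v p) (v q)"
    if "p < d * m" "q < d * m" for p q j
    unfolding v_def using sesq_rotated_product lt that by blast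
  have E: "diagonalizes (d * m) ?E v b"
    unfolding diagonalizes_def
  proof (intro conjI onb_v allI impI)
    fix p q assume pq: "p < d * m" "q < d * m"
    have "sesq (d * m) ?E (v p) (v q) = complex_of_real (1 / real d)
        * (\<Sum>j<d. phase d (p div m) ^ j * cnj (phase d (q div m) ^ j)) * sesq (d * m) (entries X) (v p) (v q)"
      unfolding sesq_sum_matrix rot[OF pq] by (simp only: sum_distrib_left sum_distrib_right mult.assoc)
    \<comment> \<open>The character sum is \<open>d\<close> inside a block and 0 between different
      blocks.\<close>
    also have "\<dots> = (if p div m = q div m then sesq (d * m) (entries X) (v p) (v q) else 0)"
      unfolding sum_phase_powers[OF lt(1)[OF pq(1)] lt(1)[OF pq(2)]] using d by simp
    also have "\<dots> = (if p = q then complex_of_real (b p) else 0)"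
      using Xv[OF pq] by auto
    finally show "sesq (d * m) ?E (v p) (v q) = (if p = q then complex_of_real (b p) else 0)" .
  qed
  \<comment> \<open>Phases cancel on the diagonal for every \<open>j\<close>, so the mixtures with
    weights \<open>lam\<close> and 1/d agree there. This turns the cross term Tr (A log B) into Tr
    (B log B).\<close>
  have Mv: "Re (sesq (d * m) ?M (v p) (v p)) = b p" if p: "p < d * m" for p
  proof -
    have "phase d s ^ j * cnj (phase d s ^ j) = 1" for s j
      by (simp add: phase_cnj flip: power_mult_distrib)
    then have "sesq (d * m) ?M (v p) (v p) = (\<Sum>j<d. complex_of_real (lam j) * complex_of_real (b p))"
      unfolding sesq_sum_matrix rot[OF p p] using Xv[OF p p] by simp
    also have "\<dots> = complex_of_real ((\<Sum>j<d. lam j) * b p)" by (simp add: sum_distrib_right)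
    finally show ?thesis using lam by (simp add: prob_dist_def)
  qed
  have Y: "?Y \<in> density (d * m)" using left_apply_phase_damping_density[OF e lam X] .
  then obtain u a where A: "diagonalizes (d * m) (entries ?Y) u a"
    using spectral_theorem unfolding density_iff positive_def by blast
  have "diagonalizes (d * m) ?M u a"
    using A left_apply_phase_damping_entry[OF e, of _ m _ lam X] sesq_cong[of "d * m" "entries ?Y" ?M]
    by (simp add: diagonalizes_def)
  from entropy_preparation_bound[OF positive_rotated[OF e] _ _ _ this E]
  have "(\<Sum>j<d. eta (lam j)) + (\<Sum>j<d. lam j * ln (1 / real d))
      \<le> (\<Sum>i<d * m. eta (a i)) + (\<Sum>p<d * m. Re (sesq (d * m) ?M (v p) (v p)) * ln (b p))"
    using X lam d by (simp add: density_iff trace_rotated[OF e] prob_dist_def)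
  also have "(\<Sum>i<d * m. eta (a i)) = vN_entropy ?Y"
    using vN_entropy_eq_sum_eta[OF _ A] Y by (simp add: density_iff)
  also have "(\<Sum>j<d. lam j * ln (1 / real d)) = - ln (real d)"
    unfolding sum_distrib_right[symmetric] using lam d by (simp add: prob_dist_def ln_div)
  also have "(\<Sum>p<d * m. Re (sesq (d * m) ?M (v p) (v p)) * ln (b p)) = (\<Sum>p<d * m. b p * ln (b p))"
    using Mv by simp
  also have "\<dots> = (\<Sum>s<d. \<Sum>k<m. (\<beta> s k / real d) * ln (\<beta> s k / real d))"
    by (simp add: sum_bipartite b_def)
  also have "\<dots> = (\<Sum>s<d. - (1 / real d * vN_entropy (B s)) - 1 / real d * ln (real d))"
  proof (intro sum.cong refl)
    fix s assume "s \<in> {..<d}"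
    then have s: "s < d" by simp
    have "(\<Sum>k<m. (\<beta> s k / real d) * ln (\<beta> s k / real d))
        = (\<Sum>k<m. - (1 / real d * eta (\<beta> s k)) - \<beta> s k * (1 / real d * ln (real d)))"
    proof (intro sum.cong refl)
      fix k assume "k \<in> {..<m}"
      \<comment> \<open>A zero eigenvalue gives 0 on both sides; otherwise the logarithm of the
        quotient splits.\<close>
      then show "(\<beta> s k / real d) * ln (\<beta> s k / real d) = - (1 / real d * eta (\<beta> s k)) - \<beta> s k * (1 / real d * ln (real d))"
        using \<beta>0[OF s, of k] d by (cases "\<beta> s k = 0") (auto simp: eta_def ln_div field_simps)
    qed
    also have "\<dots> = - (1 / real d * (\<Sum>k<m. eta (\<beta> s k))) - (\<Sum>k<m. \<beta> s k) * (1 / real d * ln (real d))"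
      by (simp only: sum_subtractf sum_negf sum_distrib_left sum_distrib_right)
    also have "(\<Sum>k<m. eta (\<beta> s k)) = vN_entropy (B s)"
      using vN_entropy_eq_sum_eta[OF _ diag[OF s]] B[OF s] by (simp add: density_iff)
    finally show "(\<Sum>k<m. (\<beta> s k / real d) * ln (\<beta> s k / real d)) = - (1 / real d * vN_entropy (B s)) - 1 / real d * ln (real d)"
      using \<beta>1[OF s] by simp
  qed
  also have "\<dots> = - (\<Sum>s<d. 1 / real d * vN_entropy (B s)) - ln (real d)"
    using d by (simp add: sum_subtractf sum_negf)
  finally show ?thesis by simp
qed

end

theorem theorem2:
  fixes d m :: nat and e :: "nat \<Rightarrow> complex vec" and lam :: "nat \<Rightarrow> real"
    and \<rho> :: "complex mat" and \<Omega> :: "complex mat \<Rightarrow> complex mat"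
  assumes "orthonormal_basis d e"
    and "prob_dist d lam"
    and "\<rho> \<in> density (d * m)"
    and "ptrace2 d m \<rho> \<in> unbiased_states d e"
    and "quantum_channel m \<Omega>"
  shows "vN_entropy (tensor_map d m (phase_damping d e lam) \<Omega> \<rho>)
           \<ge> (\<Sum>j<d. eta (lam j)) + H_chan m \<Omega> (ptrace1 d m \<rho>)
       \<and> (\<Sum>j<d. eta (lam j)) + H_chan m \<Omega> (ptrace1 d m \<rho>)
           \<ge> H_chan d (phase_damping d e lam) (ptrace2 d m \<rho>) + H_chan m \<Omega> (ptrace1 d m \<rho>)"
proof
  note e = assms(1) and lam = assms(2) and \<rho> = assms(3) and unb = assms(4) and chan = assms(5)
  \<comment> \<open>In dimension 0 the trace is an empty sum and cannot be 1.\<close>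
  have "d * m \<noteq> 0"
  proof
    assume "d * m = 0"
    then show False using \<rho> unfolding density_iff by (metis lessThan_0 sum.empty zero_neq_one)
  qed
  then have d: "0 < d" and m: "0 < m" by auto
  have lin: "linear_map_on m \<Omega>" using chan by (simp add: quantum_channel_def)
  \<comment> \<open>The diagonal blocks of \<open>\<rho>\<close> have trace 1/d by
    \<open>unbiased_diagonal\<close>, whence the factor \<open>d\<close>.\<close>
  define \<tau> where "\<tau> s = mat m m (\<lambda>(b, b'). of_nat d * block d m (($) (e s)) (entries \<rho>) b b')" for s
  have \<tau>: "\<tau> s \<in> density m" if s: "s < d" for s
  proof -
    have "positive m (\<lambda>b b'. complex_of_real (real d) * block d m (($) (e s)) (entries \<rho>) b b')"
      using \<rho> by (intro positive_scale positive_block) (auto simp: density_iff)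
    then have "positive m (entries (\<tau> s))"
      by (subst positive_cong[where M' = "\<lambda>b b'. complex_of_real (real d) * block d m (($) (e s)) (entries \<rho>) b b'"])
         (auto simp: \<tau>_def)
    moreover have "(\<Sum>b<m. \<tau> s $$ (b, b)) = of_nat d * (\<Sum>b<m. block d m (($) (e s)) (entries \<rho>) b b)"
      by (simp add: \<tau>_def sum_distrib_left)
    ultimately show ?thesis
      using d by (simp add: density_iff trace_block unbiased_diagonal[OF e unb s]) (simp add: \<tau>_def)
  qed
  have "H_chan m \<Omega> (ptrace1 d m \<rho>) \<le> (\<Sum>s<d. 1 / real d * vN_entropy (\<Omega> (\<tau> s)))"
  proof (rule H_chan_le[OF quantum_channel_density[OF chan]])
    show "ptrace1 d m \<rho> = msum m d (\<lambda>s. complex_of_real (1 / real d) \<cdot>\<^sub>m \<tau> s)"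
    proof (rule eq_matI)
      fix b b' assume "b < dim_row (msum m d (\<lambda>s. complex_of_real (1 / real d) \<cdot>\<^sub>m \<tau> s))"
        "b' < dim_col (msum m d (\<lambda>s. complex_of_real (1 / real d) \<cdot>\<^sub>m \<tau> s))"
      then have b: "b < m" "b' < m" by (auto simp: msum_def)
      show "ptrace1 d m \<rho> $$ (b, b') = msum m d (\<lambda>s. complex_of_real (1 / real d) \<cdot>\<^sub>m \<tau> s) $$ (b, b')"
        using d b by (simp add: msum_def \<tau>_def flip: sum_blocks[OF onb_of_orthonormal_basis[OF e] b])
    qed (auto simp: ptrace1_def msum_def)
  qed (use \<tau> d in auto)
  \<comment> \<open>By \<open>channel_block\<close> the normalized blocks after
    \<open>\<Omega>\<close> are the \<open>\<Omega> (\<tau> s)\<close>, so the average that bounds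
    \<open>H_chan\<close> from above reappears here.\<close>
  moreover have "(\<Sum>j<d. eta (lam j)) + (\<Sum>s<d. 1 / real d * vN_entropy (\<Omega> (\<tau> s)))
      \<le> vN_entropy (tensor_map d m (phase_damping d e lam) \<Omega> \<rho>)"
    unfolding tensor_map_def
    by (rule entropy_phase_damping_ge[OF e m lam right_apply_density[OF chan \<rho>]])
       (use quantum_channel_density[OF chan] \<tau> channel_block[OF lin] in \<open>auto simp: \<tau>_def\<close>)
  ultimately show "vN_entropy (tensor_map d m (phase_damping d e lam) \<Omega> \<rho>)
      \<ge> (\<Sum>j<d. eta (lam j)) + H_chan m \<Omega> (ptrace1 d m \<rho>)" by linarith
  show "(\<Sum>j<d. eta (lam j)) + H_chan m \<Omega> (ptrace1 d m \<rho>)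
      \<ge> H_chan d (phase_damping d e lam) (ptrace2 d m \<rho>) + H_chan m \<Omega> (ptrace1 d m \<rho>)"
    using H_phase_damping_le[OF e lam unb] by simp
qed

end
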